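(* Let $D$ be a weighted rooted tree with root $x_0$ such that $\deg_D(x_0)=1$ and, for all $x\in V(D)$, $w(x)\geq 2$ if $\deg_D(x)\geq 2$. Then $I(D)^{(s)}=I(D)^s$ for all $s\geq 2$.
   Context: A weighted oriented graph $D=(V(D),E(D),w)$ has a finite simple underlying graph, each edge $\{x,y\}$ given exactly one orientation, $(x,y)\in E(D)$ meaning $x\to y$, and a weight function $w:V(D)\to\mathbb N=\{1,2,\ldots\}$. Convention: every source vertex (a vertex with no incoming edge) has weight $1$. A (weighted) rooted tree is a (weighted) oriented tree in which all edges are oriented away from the root. $\deg_D(x)$ is the number of neighbours of $x$ in the underlying graph. Let $k$ be a field; vertices are identified with variables of a polynomial ring $R$ over $k$. The edge ideal is $I(D)=(xy^{w(y)}\mid (x,y)\in E(D))\subseteq R$. For a homogeneous ideal $I\subseteq R$ and $s\geq 1$, the $s$-th symbolic power is $I^{(s)}=\bigcap_{P\in\operatorname{Ass} I}(I^sR_P\cap R)$, over all associated primes of $I$. *)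

theory Defs
  imports
    "Graph_Theory.Digraph_Component"
    "HOL-Algebra.Ideal_Product"
    "HOL-Algebra.QuotRing"
    "HOL-Library.Poly_Mapping"
begin

section \<open>Weighted rooted trees\<close>

text \<open>A digraph is given by its vertex set \<open>pverts D\<close> and its set \<open>parcs D\<close> of ordered pairs;
  \<open>pair_digraph\<close> requires it to be finite and loop-free. The underlying undirected graph is
  represented by its symmetric digraph \<open>mk_symmetric D\<close>.\<close>

definition oriented_graph :: "'v pair_pre_digraph \<Rightarrow> bool" where
  "oriented_graph D \<longleftrightarrow>
     pair_digraph D \<and> (\<forall>x y. (x, y) \<in> parcs D \<longrightarrow> (y, x) \<notin> parcs D)"

definition weighted_oriented_graph :: "'v pair_pre_digraph \<Rightarrow> ('v \<Rightarrow> nat) \<Rightarrow> bool" where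
  "weighted_oriented_graph D w \<longleftrightarrow>
     oriented_graph D \<and>
     (\<forall>x \<in> pverts D. 1 \<le> w x) \<and>
     (\<forall>x \<in> pverts D. in_arcs (with_proj D) x = {} \<longrightarrow> w x = 1)"

definition neighbours :: "'v pair_pre_digraph \<Rightarrow> 'v \<Rightarrow> 'v set" where
  "neighbours D x = {y \<in> pverts D. (x, y) \<in> parcs (mk_symmetric (with_proj D))}"

definition graph_degree :: "'v pair_pre_digraph \<Rightarrow> 'v \<Rightarrow> nat" where
  "graph_degree D x = card (neighbours D x)"

text \<open>In the symmetric digraph of a simple graph, traversing one edge back and forth is a directed
  cycle of length 2, so the cycles of the graph are those of length at least 3. The library's
  \<open>tree\<close> only excludes directed cycles and is not the notion needed here.\<close>

definition oriented_tree :: "'v pair_pre_digraph \<Rightarrow> bool" where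
  "oriented_tree D \<longleftrightarrow>
     oriented_graph D \<and>
     Digraph_Component.connected (with_proj D) \<and>
     (\<nexists>p. pre_digraph.cycle (with_proj (mk_symmetric (with_proj D))) p \<and> 3 \<le> length p)"

text \<open>An edge \<open>(x, y)\<close> is oriented away from \<open>x\<^sub>0\<close> if the path from \<open>x\<^sub>0\<close> to \<open>y\<close> in the underlying
  tree ends by traversing the edge from \<open>x\<close> to \<open>y\<close>.\<close>

definition rooted_tree :: "'v pair_pre_digraph \<Rightarrow> 'v \<Rightarrow> bool" where
  "rooted_tree D x\<^sub>0 \<longleftrightarrow>
     oriented_tree D \<and> x\<^sub>0 \<in> pverts D \<and>
     (\<forall>(x, y) \<in> parcs D.
        \<exists>p. pre_digraph.apath (with_proj (mk_symmetric (with_proj D))) x\<^sub>0 (p @ [(x, y)]) y)"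

definition weighted_rooted_tree :: "'v pair_pre_digraph \<Rightarrow> ('v \<Rightarrow> nat) \<Rightarrow> 'v \<Rightarrow> bool" where
  "weighted_rooted_tree D w x\<^sub>0 \<longleftrightarrow> weighted_oriented_graph D w \<and> rooted_tree D x\<^sub>0"


section \<open>Polynomial rings and edge ideals\<close>

type_synonym ('v, 'k) mpoly = "('v \<Rightarrow>\<^sub>0 nat) \<Rightarrow>\<^sub>0 'k"

text \<open>The polynomial ring over \<open>'k\<close> whose variables are the elements of \<open>V\<close>.\<close>

definition poly_ring :: "'v set \<Rightarrow> ('v, 'k::comm_ring_1) mpoly ring" where
  "poly_ring V =
     \<lparr>carrier = {p. \<forall>m \<in> Poly_Mapping.keys p. Poly_Mapping.keys m \<subseteq> V},
      monoid.mult = (*), one = 1, zero = 0, add = (+)\<rparr>"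

definition var :: "'v \<Rightarrow> ('v, 'k::comm_ring_1) mpoly" where
  "var x = Poly_Mapping.single (Poly_Mapping.single x 1) 1"

definition edge_ideal ::
    "'v pair_pre_digraph \<Rightarrow> ('v \<Rightarrow> nat) \<Rightarrow> ('v, 'k::comm_ring_1) mpoly set" where
  "edge_ideal D w =
     Idl\<^bsub>poly_ring (pverts D)\<^esub> {var x * var y ^ w y |x y. (x, y) \<in> parcs D}"


section \<open>Localization\<close>

definition fraction_rel :: "('a, 'm) ring_scheme \<Rightarrow> 'a set \<Rightarrow> (('a \<times> 'a) \<times> ('a \<times> 'a)) set" where
  "fraction_rel R S =
     {((a, s), (b, t)). a \<in> carrier R \<and> b \<in> carrier R \<and> s \<in> S \<and> t \<in> S \<and>
        (\<exists>u \<in> S. u \<otimes>\<^bsub>R\<^esub> (a \<otimes>\<^bsub>R\<^esub> t) = u \<otimes>\<^bsub>R\<^esub> (b \<otimes>\<^bsub>R\<^esub> s))}"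

definition fraction :: "('a, 'm) ring_scheme \<Rightarrow> 'a set \<Rightarrow> 'a \<Rightarrow> 'a \<Rightarrow> ('a \<times> 'a) set" where
  "fraction R S a s = fraction_rel R S `` {(a, s)}"

definition localization :: "('a, 'm) ring_scheme \<Rightarrow> 'a set \<Rightarrow> ('a \<times> 'a) set ring" where
  "localization R S =
     \<lparr>carrier = (carrier R \<times> S) // fraction_rel R S,
      monoid.mult = (\<lambda>X Y. \<Union>(a, s) \<in> X. \<Union>(b, t) \<in> Y. fraction R S (a \<otimes>\<^bsub>R\<^esub> b) (s \<otimes>\<^bsub>R\<^esub> t)),
      one = fraction R S \<one>\<^bsub>R\<^esub> \<one>\<^bsub>R\<^esub>,
      zero = fraction R S \<zero>\<^bsub>R\<^esub> \<one>\<^bsub>R\<^esub>,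
      add = (\<lambda>X Y. \<Union>(a, s) \<in> X. \<Union>(b, t) \<in> Y.
               fraction R S (a \<otimes>\<^bsub>R\<^esub> t \<oplus>\<^bsub>R\<^esub> b \<otimes>\<^bsub>R\<^esub> s) (s \<otimes>\<^bsub>R\<^esub> t))\<rparr>"

definition extension_ideal :: "('a, 'm) ring_scheme \<Rightarrow> 'a set \<Rightarrow> 'a set \<Rightarrow> ('a \<times> 'a) set set" where
  "extension_ideal R S I = Idl\<^bsub>localization R S\<^esub> ((\<lambda>a. fraction R S a \<one>\<^bsub>R\<^esub>) ` I)"

text \<open>\<open>I R\<^sub>P \<inter> R\<close>, where the intersection is the preimage under the canonical map \<open>R \<rightarrow> R\<^sub>P\<close>.\<close>

definition local_contraction :: "('a, 'm) ring_scheme \<Rightarrow> 'a set \<Rightarrow> 'a set \<Rightarrow> 'a set" where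
  "local_contraction R P I =
     {r \<in> carrier R. fraction R (carrier R - P) r \<one>\<^bsub>R\<^esub> \<in> extension_ideal R (carrier R - P) I}"


section \<open>Symbolic powers\<close>

text \<open>The primes that are annihilators of elements of the \<open>R\<close>-module \<open>R / I\<close>.\<close>

definition associated_primes :: "('a, 'm) ring_scheme \<Rightarrow> 'a set \<Rightarrow> 'a set set" where
  "associated_primes R I =
     {P. primeideal P R \<and>
         (\<exists>x \<in> carrier (R Quot I).
            P = {r \<in> carrier R. (I +>\<^bsub>R\<^esub> r) \<otimes>\<^bsub>R Quot I\<^esub> x = \<zero>\<^bsub>R Quot I\<^esub>})}"

definition ideal_power :: "('a, 'm) ring_scheme \<Rightarrow> 'a set \<Rightarrow> nat \<Rightarrow> 'a set" where
  "ideal_power R I s = I [^]\<^bsub>ideals_set R\<^esub> s"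

text \<open>The intersection is taken inside \<open>R\<close>, so that it is \<open>R\<close> if there are no associated primes.\<close>

definition symbolic_power :: "('a, 'm) ring_scheme \<Rightarrow> 'a set \<Rightarrow> nat \<Rightarrow> 'a set" where
  "symbolic_power R I s =
     carrier R \<inter> (\<Inter>P \<in> associated_primes R I. local_contraction R P (ideal_power R I s))"

end

theory Submission
  imports Defs
begin

text \<open>Write \<open>I\<close> for the edge ideal, \<open>x0\<close> for the root and \<open>x1\<close> for its only child. One inclusion
  is immediate, as \<open>I\<^sup>s\<close> is contained in each of its local contractions. For the other one two
  associated primes suffice: the ideals generated by all variables except \<open>x0\<close> and by all
  variables except \<open>x1\<close>. Both are colon ideals \<open>I : f\<close> of explicit monomials \<open>f\<close>
  (\<open>colon_root\<close>, \<open>colon_child\<close>); this uses that the weights of the inner vertices are at least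
  two. Contracting \<open>I\<^sup>s\<close> from the localization at the prime that omits \<open>x\<close> inverts \<open>x\<close>, so the
  symbolic power lies in the intersection of \<open>I\<^sup>s : x0\<^sup>\<infinity>\<close> and \<open>I\<^sup>s : x1\<^sup>\<infinity>\<close>
  (\<open>local_contraction_colon\<close>, \<open>colon_in_saturation\<close>).

  It remains to see that a monomial \<open>m\<close> lies in \<open>I\<^sup>s\<close> if both \<open>m x0\<^sup>a\<close> and \<open>m x1\<^sup>b\<close> do. This
  is a statement about multisets of \<open>s\<close> arcs of the tree whose product of generators divides a
  given monomial, called packings below. The packing for \<open>m x1\<^sup>b\<close> respects the exponent of
  \<open>x0\<close>, and the packing for \<open>m x0\<^sup>a\<close> respects all other exponents. If the latter uses too many
  copies of the arc \<open>(x0, x1)\<close>, some of them can be traded for arcs below \<open>x1\<close> without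
  exceeding the exponent of \<open>x1\<close> (\<open>saturations_meet\<close>). The trade rests on an augmentation
  property of packings in the branches of a tree (\<open>augmentable\<close>): a packing that is not of
  maximal size can gain one arc, and outside the branch this costs at most one further copy of
  the tail of the arc into the branch.\<close>

section \<open>Rooted trees\<close>

lemma (in pair_wf_digraph) awalk_reverse:
  assumes "sym (parcs G)" and "awalk u p v"
  shows "awalk v (rev (map prod.swap p)) u"
    and "pawalk_verts v (rev (map prod.swap p)) = rev (pawalk_verts u p)"
proof -
  have "awalk v (rev (map prod.swap p)) u \<and>
    pawalk_verts v (rev (map prod.swap p)) = rev (pawalk_verts u p)"
    using assms(2)
  proof (induction p arbitrary: u)
    case Nil
    then show ?case by (auto simp: awalk_Nil_iff)
  next
    case (Cons e p)
    obtain a b where e: "e = (a, b)" by (cases e)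
    have ab: "a = u" "(u, b) \<in> parcs G" "awalk b p v"
      using Cons.prems by (auto simp: awalk_Cons_iff e)
    have ih: "awalk v (rev (map prod.swap p)) b"
      "pawalk_verts v (rev (map prod.swap p)) = rev (pawalk_verts b p)"
      using Cons.IH[OF ab(3)] by auto
    have "(b, u) \<in> parcs G" using assms(1) ab(2) by (auto dest: symD)
    then have last: "awalk b [(b, u)] u" by (auto simp: awalk_Cons_iff awalk_Nil_iff in_arcsD1 in_arcsD2)
    have w: "awalk v (rev (map prod.swap p) @ [(b, u)]) u"
      using ih(1) last by (rule awalk_appendI)
    have "pawalk_verts v (rev (map prod.swap p) @ [(b, u)]) = rev (pawalk_verts b p) @ [u]"
      using awalk_verts_append[OF w] ih by simp
    then show ?case using w by (simp add: e ab(1))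
  qed
  then show "awalk v (rev (map prod.swap p)) u"
    and "pawalk_verts v (rev (map prod.swap p)) = rev (pawalk_verts u p)" by auto
qed

text \<open>If two paths with the same ends meet at an inner vertex, they can be cut there and both
  halves are shorter pairs; if they do not, one followed by the reverse of the other is a
  cycle, and its length is at least 3 unless both paths are the same single arc.\<close>
lemma (in pair_wf_digraph) apath_unique:
  assumes sym: "sym (parcs G)"
    and acyclic: "\<And>c. cycle c \<Longrightarrow> length c < 3"
    and "apath u p v" and "apath u q v"
  shows "p = q"
  using assms(3,4)
proof (induction "length p + length q" arbitrary: u v p q rule: less_induct)
  case less
  show ?case
  proof (cases "p = [] \<or> q = []")
    case True
    then have "u = v" using less.prems by (auto simp: apath_Nil_iff)
    then show ?thesis using less.prems apath_nonempty_ends by metis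
  next
    case False
    then have "p \<noteq> []" "q \<noteq> []" by auto
    have wp: "awalk u p v" "distinct (pawalk_verts u p)"
      and wq: "awalk u q v" "distinct (pawalk_verts u q)"
      using less.prems by (auto simp: apath_def)
    show ?thesis
    proof (cases "set (pawalk_verts u p) \<inter> set (pawalk_verts u q) \<subseteq> {u, v}")
      case False
      then obtain x where x: "x \<in> set (pawalk_verts u p)" "x \<in> set (pawalk_verts u q)"
        "x \<noteq> u" "x \<noteq> v" by auto
      obtain p1 p2 where p: "p = p1 @ p2" "awalk u p1 x" "awalk x p2 v"
        using awalk_decomp[OF wp(1) x(1)] by auto
      obtain q1 q2 where q: "q = q1 @ q2" "awalk u q1 x" "awalk x q2 v"
        using awalk_decomp[OF wq(1) x(2)] by auto
      have ap: "apath u p1 x" "apath x p2 v"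
        using less.prems(1) p by (auto simp: apath_append_iff)
      have aq: "apath u q1 x" "apath x q2 v"
        using less.prems(2) q by (auto simp: apath_append_iff)
      have "p1 \<noteq> []" "p2 \<noteq> []" "q1 \<noteq> []" "q2 \<noteq> []"
        using p q x by (auto simp: awalk_Nil_iff)
      then have "length p1 + length q1 < length p + length q"
        "length p2 + length q2 < length p + length q" using p q by auto
      then show ?thesis using less.hyps ap aq p q by blast
    next
      case True
      define r where "r = rev (map prod.swap q)"
      have r: "awalk v r u" "pawalk_verts v r = rev (pawalk_verts u q)"
        unfolding r_def using awalk_reverse[OF sym wq(1)] by auto
      have c: "awalk u (p @ r) u" using wp(1) r(1) by (rule awalk_appendI)
      obtain ps where ps: "pawalk_verts u p = u # ps"
        using wp(1) by (cases p) (auto simp: awalk_Cons_iff)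
      obtain qs where qs: "pawalk_verts u q = u # qs"
        using wq(1) by (cases q) (auto simp: awalk_Cons_iff)
      have "qs \<noteq> []" using qs \<open>q \<noteq> []\<close> by (cases q) auto
      have "last qs = v"
        using awlast_of_awalk[OF wq(1)] qs \<open>qs \<noteq> []\<close> by simp
      have tl: "tl (rev (u # qs)) = rev (butlast qs) @ [u]"
        using \<open>qs \<noteq> []\<close> by (cases qs rule: rev_cases) auto
      have "last (pawalk_verts u p) = v" using awlast_of_awalk[OF wp(1)] by simp
      then have append: "pawalk_verts u (p @ r) = pawalk_verts u p @ tl (pawalk_verts v r)"
        using awalk_verts_append[OF c] by simp
      have "pawalk_verts u (p @ r) = (u # ps) @ rev (butlast qs) @ [u]"
        using append r(2) ps qs tl by simp
      then have verts: "tl (pawalk_verts u (p @ r)) = ps @ rev (butlast qs) @ [u]" by simp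
      have "v \<notin> set (butlast qs)"
        using wq(2) qs \<open>qs \<noteq> []\<close> \<open>last qs = v\<close> by (cases qs rule: rev_cases) auto
      moreover have "u \<notin> set ps" "u \<notin> set qs" "distinct ps" "distinct qs"
        using wp wq ps qs by auto
      moreover have "set ps \<inter> set (butlast qs) \<subseteq> {u, v}"
        using True ps qs by (auto dest: in_set_butlastD)
      ultimately have "distinct (tl (pawalk_verts u (p @ r)))"
        unfolding verts by (auto simp: distinct_butlast dest: in_set_butlastD)
      then have "cycle (p @ r)" using c \<open>p \<noteq> []\<close> by (auto simp: cycle_def)
      then have "length p + length q < 3" using acyclic[of "p @ r"] by (simp add: r_def)
      moreover have "0 < length p" "0 < length q" using \<open>p \<noteq> []\<close> \<open>q \<noteq> []\<close> by auto
      ultimately have "length p = 1" "length q = 1" by linarith+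
      then obtain a b where "p = [a]" "q = [b]"
        by (auto simp: length_Suc_conv)
      then show ?thesis using wp(1) wq(1)
        by (auto simp: awalk_Cons_iff awalk_Nil_iff intro: prod_eqI)
    qed
  qed
qed

text \<open>A rooted tree described without paths: unique parents give the tree structure, and descent
  along \<open>E\<close> is well-founded because \<open>E\<close> is finite and acyclic.\<close>
locale arborescence =
  fixes V :: "'v set" and E :: "'v rel" and x0 :: 'v
  assumes finite_V: "finite V" and root_in: "x0 \<in> V"
    and arcs_sub: "E \<subseteq> V \<times> V"
    and acyc: "acyclic E"
    and unique_parent: "\<And>x y z. (x, z) \<in> E \<Longrightarrow> (y, z) \<in> E \<Longrightarrow> x = y"
    and no_parent_root: "\<And>x. (x, x0) \<notin> E"
    and has_parent: "\<And>y. y \<in> V \<Longrightarrow> y \<noteq> x0 \<Longrightarrow> \<exists>x. (x, y) \<in> E"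

lemma parcs_symmetrization: "parcs (mk_symmetric (with_proj D)) = parcs D \<union> (parcs D)\<inverse>"
  by (auto simp: parcs_mk_symmetric)

text \<open>Since paths in the underlying tree are unique, the number of arcs of the path from the root
  is a well-defined depth, and an arc of the tree raises it by one. A vertex other than the
  root is entered by the last arc of its path from the root; were that arc oriented the other
  way, the depth would have to change by one in both directions at once.\<close>
lemma rooted_tree_arborescence:
  assumes "rooted_tree D x0"
  shows "arborescence (pverts D) (parcs D) x0"
proof -
  let ?H = "mk_symmetric (with_proj D)"
  have o: "oriented_graph D" and con: "Digraph_Component.connected (with_proj D)"
    and cyc: "\<And>c. pre_digraph.cycle (with_proj ?H) c \<Longrightarrow> length c < 3"
    and root: "x0 \<in> pverts D"
    and away: "\<And>x y. (x, y) \<in> parcs D \<Longrightarrow>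
      \<exists>p. pre_digraph.apath (with_proj ?H) x0 (p @ [(x, y)]) y"
    using assms by (force simp: rooted_tree_def oriented_tree_def)+
  interpret D: pair_digraph D using o by (simp add: oriented_graph_def)
  interpret H: pair_digraph ?H by (rule D.digraph_mk_symmetric)
  note parcs_H = parcs_symmetrization[of D]
  have symH: "sym (parcs ?H)" by (auto simp: parcs_H sym_def)
  have uniq: "p = q" if "H.apath u p v" "H.apath u q v" for u p q v
    using H.apath_unique[OF symH cyc that] by simp
  define depth where "depth y = length (THE p. H.apath x0 p y)" for y
  have depth: "depth y = length p" if "H.apath x0 p y" for p y
    unfolding depth_def using uniq that by (metis the_equality)
  have depth_arc: "depth y = Suc (depth x)" if "H.apath x0 (p @ [(x, y)]) y" for p x y
  proof -
    have "H.apath x0 p x" using that by (auto simp: H.apath_append_iff H.apath_Cons_iff)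
    then show ?thesis using depth that by fastforce
  qed
  have depth_E: "depth y = Suc (depth x)" if "(x, y) \<in> parcs D" for x y
    using away[OF that] depth_arc by blast
  show ?thesis
  proof
    show "finite (pverts D)" by simp
    show "x0 \<in> pverts D" by (rule root)
    show "parcs D \<subseteq> pverts D \<times> pverts D" by (auto dest: D.in_arcsD1 D.in_arcsD2)
    have "parcs D \<subseteq> measure depth" using depth_E by auto
    then show "acyclic (parcs D)"
      using wf_acyclic[OF wf_measure] acyclic_subset by blast
  next
    fix x y z assume "(x, z) \<in> parcs D" "(y, z) \<in> parcs D"
    then obtain p q where "H.apath x0 (p @ [(x, z)]) z" "H.apath x0 (q @ [(y, z)]) z"
      using away by blast
    then have "p @ [(x, z)] = q @ [(y, z)]" by (rule uniq)
    then show "x = y" by simp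
  next
    fix x show "(x, x0) \<notin> parcs D"
      using away[of x x0] H.apath_nonempty_ends by blast
  next
    fix y assume y: "y \<in> pverts D" "y \<noteq> x0"
    have "x0 \<rightarrow>\<^sup>*\<^bsub>with_proj ?H\<^esub> y"
      using con y root by (auto simp: connected_def strongly_connected_def)
    then obtain p where p: "H.apath x0 p y" by (auto simp: H.reachable_apath)
    with y have "p \<noteq> []" by (auto simp: H.apath_Nil_iff)
    then obtain q e where "p = q @ [e]" by (cases p rule: rev_cases) auto
    moreover obtain a b where "e = (a, b)" by (cases e)
    ultimately have q: "p = q @ [(a, b)]" by simp
    with p have "b = y" by (auto simp: H.apath_append_iff H.apath_Cons_iff H.apath_Nil_iff)
    have "depth y = Suc (depth a)" using depth_arc p q \<open>b = y\<close> by blast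
    then have "(y, a) \<notin> parcs D" using depth_E by fastforce
    moreover have "(a, y) \<in> parcs ?H"
      using p q \<open>b = y\<close> by (auto simp: H.apath_append_iff H.apath_Cons_iff)
    ultimately show "\<exists>x. (x, y) \<in> parcs D" by (auto simp: parcs_H)
  qed
qed

section \<open>Augmenting packings in a tree\<close>

text \<open>The arc ending in \<open>z\<close> is represented by \<open>z\<close>, so \<open>c\<close> is a multiset of arcs. The generator of
  an arc uses \<open>w y\<close> copies of its head \<open>y\<close> and one copy of its tail; hence on a set \<open>F\<close>
  containing all heads and tails the predicate says, for \<open>c\<close> vanishing at the root, that the
  product of the generators in \<open>c\<close> divides the monomial with exponents \<open>m\<close>. Restricting \<open>F\<close>
  imposes the condition at these vertices only.\<close>
definition packs :: "'v rel \<Rightarrow> ('v \<Rightarrow> nat) \<Rightarrow> 'v set \<Rightarrow> ('v \<Rightarrow> nat) \<Rightarrow> ('v \<Rightarrow> nat) \<Rightarrow> bool" where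
  "packs E w F m c \<longleftrightarrow> (\<forall>y\<in>F. w y * c y + (\<Sum>z\<in>E `` {y}. c z) \<le> m y)"

lemma packs_mono:
  assumes "packs E w F m d" and "\<And>y. c y \<le> d y"
  shows "packs E w F m c"
  unfolding packs_def
proof
  fix y assume "y \<in> F"
  have "w y * c y + (\<Sum>z\<in>E `` {y}. c z) \<le> w y * d y + (\<Sum>z\<in>E `` {y}. d z)"
    using assms(2) by (intro add_mono mult_le_mono sum_mono) auto
  also have "\<dots> \<le> m y" using assms(1) \<open>y \<in> F\<close> by (simp add: packs_def)
  finally show "w y * c y + (\<Sum>z\<in>E `` {y}. c z) \<le> m y" .
qed

lemma packs_subset: "packs E w G m c \<Longrightarrow> F \<subseteq> G \<Longrightarrow> packs E w F m c"
  by (auto simp: packs_def)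

lemma packs_cong:
  assumes "\<And>y. y \<in> F \<Longrightarrow> c y = d y" and "\<And>y. y \<in> F \<Longrightarrow> E `` {y} \<subseteq> F"
  shows "packs E w F m c \<longleftrightarrow> packs E w F m d"
proof -
  have "(\<Sum>z\<in>E `` {y}. c z) = (\<Sum>z\<in>E `` {y}. d z)" if "y \<in> F" for y
    using assms that by (intro sum.cong) auto
  then show ?thesis using assms(1) by (simp add: packs_def)
qed

lemma shrink_to_sum:
  fixes d :: "'v \<Rightarrow> nat"
  assumes "finite F" and "n \<le> sum d F"
  obtains e where "\<And>y. e y \<le> d y" and "sum e F = n"
proof -
  have "\<exists>e. (\<forall>y. e y \<le> d y) \<and> sum e F = n" using assms
  proof (induction F arbitrary: n rule: finite_induct)
    case empty
    then show ?case by (intro exI[of _ d]) auto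
  next
    case (insert x F)
    obtain e where e: "\<forall>y. e y \<le> d y" "sum e F = min n (sum d F)"
      using insert.IH[of "min n (sum d F)"] by auto
    let ?e = "e(x := n - min n (sum d F))"
    have "sum ?e F = sum e F" using insert.hyps by (intro sum.cong) auto
    then have "sum ?e (insert x F) = n" using insert.hyps e by simp
    moreover have "\<forall>y. ?e y \<le> d y" using e insert by auto
    ultimately show ?case by blast
  qed
  then show ?thesis using that by blast
qed

context arborescence
begin

definition below :: "'v \<Rightarrow> 'v set" where
  "below y = E\<^sup>* `` {y}"

definition below_set :: "'v set \<Rightarrow> 'v set" where
  "below_set Z = (\<Union>z\<in>Z. below z)"

lemma finite_E: "finite E"
  using finite_subset[OF arcs_sub] finite_V by blast

lemma finite_children: "finite (E `` {y})"
  using finite_E by (rule finite_Image)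

lemma finite_below: "finite (below y)"
proof -
  have "E\<^sup>* `` {y} \<subseteq> insert y (Range E)" by (auto elim: rtranclE)
  then show ?thesis unfolding below_def using finite_E finite_subset
    by (metis finite_Range finite_insert)
qed

lemma finite_below_set: "finite Z \<Longrightarrow> finite (below_set Z)"
  by (simp add: below_set_def finite_below)

lemma self_below: "y \<in> below y"
  by (simp add: below_def)

lemma children_below: "v \<in> below y \<Longrightarrow> E `` {v} \<subseteq> below y"
  by (auto simp: below_def)

lemma children_below_set: "v \<in> below_set Z \<Longrightarrow> E `` {v} \<subseteq> below_set Z"
  using children_below by (force simp: below_set_def)

lemma below_eq: "below y = insert y (below_set (E `` {y}))"
  by (auto simp: below_def below_set_def elim: converse_rtranclE)

lemma not_below_children: "y \<notin> below_set (E `` {y})"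
  using acyc by (auto simp: below_def below_set_def acyclic_def dest: rtrancl_into_trancl2)

lemma below_comparable:
  assumes "(x, z) \<in> E\<^sup>*" and "(y, z) \<in> E\<^sup>*"
  shows "(x, y) \<in> E\<^sup>* \<or> (y, x) \<in> E\<^sup>*"
  using assms
proof (induction rule: rtrancl_induct)
  case base
  then show ?case by blast
next
  case (step u v)
  show ?case
  proof (cases "y = v")
    case True
    then show ?thesis using step by (meson rtrancl.rtrancl_into_rtrancl)
  next
    case False
    then obtain u' where "(y, u') \<in> E\<^sup>*" "(u', v) \<in> E"
      using step.prems by (meson rtranclE)
    then show ?thesis using step unique_parent by blast
  qed
qed

lemma siblings_disjoint:
  assumes "u \<in> E `` {y}" and "v \<in> E `` {y}" and "u \<noteq> v"
  shows "below u \<inter> below v = {}"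
proof -
  have no: False if ab: "(a, b) \<in> E\<^sup>*" "(y, a) \<in> E" "(y, b) \<in> E" "a \<noteq> b" for a b
  proof -
    obtain p where "(a, p) \<in> E\<^sup>*" "(p, b) \<in> E" using ab by (metis rtranclE)
    then have "(a, y) \<in> E\<^sup>*" using unique_parent ab by blast
    then show False using ab acyc by (auto simp: acyclic_def dest: rtrancl_into_trancl2)
  qed
  show ?thesis
    using no[of u v] no[of v u] assms below_comparable by (auto simp: below_def)
qed

text \<open>An exchange property of the packings in the branch at \<open>z\<close>: a packing that is not of maximal
  size can be replaced by one that has one arc more and that uses at most one more copy of the
  arc into \<open>z\<close>, hence at most one more copy of the parent of \<open>z\<close>.\<close>
definition augmentable :: "('v \<Rightarrow> nat) \<Rightarrow> ('v \<Rightarrow> nat) \<Rightarrow> 'v \<Rightarrow> bool" where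
  "augmentable w m z \<longleftrightarrow> (\<forall>c d.
     packs E w (below z) m c \<longrightarrow> packs E w (below z) m d \<longrightarrow>
     sum c (below z) < sum d (below z) \<longrightarrow>
     (\<exists>e. packs E w (below z) m e \<and> sum e (below z) = Suc (sum c (below z)) \<and> e z \<le> Suc (c z)))"

text \<open>If \<open>d\<close> is larger than \<open>c\<close> on a disjoint union of branches, it is larger on one of them; only
  that branch has to be changed.\<close>
lemma augment_forest_once:
  assumes Z: "finite Z" "\<And>u v. u \<in> Z \<Longrightarrow> v \<in> Z \<Longrightarrow> u \<noteq> v \<Longrightarrow> below u \<inter> below v = {}"
    and aug: "\<And>z. z \<in> Z \<Longrightarrow> augmentable w m z"
    and c: "packs E w (below_set Z) m c" and d: "packs E w (below_set Z) m d"
    and less: "sum c (below_set Z) < sum d (below_set Z)"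
  obtains e where "packs E w (below_set Z) m e"
    and "sum e (below_set Z) = Suc (sum c (below_set Z))" and "sum e Z \<le> Suc (sum c Z)"
proof -
  have split: "sum f (below_set Z) = (\<Sum>z\<in>Z. sum f (below z))" for f :: "'v \<Rightarrow> nat"
    unfolding below_set_def using Z finite_below by (intro sum.UNION_disjoint) auto
  have "\<exists>z\<in>Z. sum c (below z) < sum d (below z)"
  proof (rule ccontr)
    assume "\<not> ?thesis"
    then have "sum d (below_set Z) \<le> sum c (below_set Z)"
      unfolding split by (intro sum_mono[of Z]) (auto simp: not_less)
    then show False using less by simp
  qed
  then obtain z where z: "z \<in> Z" "sum c (below z) < sum d (below z)" by blast
  have sub: "below z \<subseteq> below_set Z" using z(1) by (auto simp: below_set_def)
  obtain e where e: "packs E w (below z) m e"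
    "sum e (below z) = Suc (sum c (below z))" "e z \<le> Suc (c z)"
    using aug[OF z(1)] z(2) packs_subset[OF c sub] packs_subset[OF d sub]
    unfolding augmentable_def by blast
  define f where "f y = (if y \<in> below z then e y else c y)" for y
  have fz: "packs E w (below z) m f"
    using e(1) packs_cong[of "below z" f e E w m] children_below by (auto simp: f_def)
  have fc: "f y = c y" if "u \<in> Z" "u \<noteq> z" "y \<in> below u" for u y
    using Z(2)[OF that(1) z(1) that(2)] that(3) by (auto simp: f_def)
  have fu: "packs E w (below u) m f" if "u \<in> Z" for u
  proof (cases "u = z")
    case False
    have "packs E w (below u) m c"
      using packs_subset[OF c] that by (auto simp: below_set_def)
    then show ?thesis
      using packs_cong[of "below u" f c E w m] fc[OF that False] children_below by auto
  qed (simp add: fz)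
  have 1: "packs E w (below_set Z) m f"
    using fu by (auto simp: packs_def below_set_def)
  have "sum f (below u) = sum c (below u) + (if u = z then 1 else 0)" if "u \<in> Z" for u
  proof (cases "u = z")
    case True
    then show ?thesis using e(2) by (simp add: f_def cong: sum.cong)
  next
    case False
    then show ?thesis using fc[OF that] by simp
  qed
  then have 2: "sum f (below_set Z) = Suc (sum c (below_set Z))"
    unfolding split using Z(1) z(1) by (simp add: sum.distrib)
  have "f u \<le> c u + (if u = z then 1 else 0)" if "u \<in> Z" for u
  proof (cases "u = z")
    case True
    then show ?thesis using e(3) by (simp add: f_def self_below)
  next
    case False
    then show ?thesis using fc[OF that False self_below] by simp
  qed
  then have "sum f Z \<le> (\<Sum>u\<in>Z. c u + (if u = z then 1 else 0))" by (rule sum_mono)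
  also have "\<dots> = Suc (sum c Z)" using Z(1) z(1) by (simp add: sum.distrib)
  finally show thesis using 1 2 that by blast
qed

lemma augment_forest:
  assumes Z: "finite Z" "\<And>u v. u \<in> Z \<Longrightarrow> v \<in> Z \<Longrightarrow> u \<noteq> v \<Longrightarrow> below u \<inter> below v = {}"
    and aug: "\<And>z. z \<in> Z \<Longrightarrow> augmentable w m z"
    and c: "packs E w (below_set Z) m c" and d: "packs E w (below_set Z) m d"
    and le: "sum c (below_set Z) \<le> sum d (below_set Z)"
  obtains e where "packs E w (below_set Z) m e"
    and "sum e (below_set Z) = sum d (below_set Z)"
    and "sum e Z + sum c (below_set Z) \<le> sum c Z + sum d (below_set Z)"
proof -
  have "\<exists>e. packs E w (below_set Z) m e \<and> sum e (below_set Z) = sum d (below_set Z) \<and>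
    sum e Z + sum c (below_set Z) \<le> sum c Z + sum d (below_set Z)"
    using c le
  proof (induction "sum d (below_set Z) - sum c (below_set Z)" arbitrary: c)
    case 0
    then show ?case by (intro exI[of _ c]) auto
  next
    case (Suc k)
    then have "sum c (below_set Z) < sum d (below_set Z)" by simp
    from augment_forest_once[OF Z aug Suc.prems(1) d this]
    obtain b where b: "packs E w (below_set Z) m b"
      "sum b (below_set Z) = Suc (sum c (below_set Z))" "sum b Z \<le> Suc (sum c Z)" by blast
    have "k = sum d (below_set Z) - sum b (below_set Z)" "sum b (below_set Z) \<le> sum d (below_set Z)"
      using Suc.hyps(2) b(2) by auto
    from Suc.hyps(1)[OF this(1) b(1) this(2)] b show ?case by fastforce
  qed
  then show thesis using that by blast
qed

text \<open>Induction from the leaves towards the root. Let \<open>d\<close> be a larger packing of the branch at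
  \<open>z\<close>. If \<open>d z \<le> c z + 1\<close>, discarding arcs from \<open>d\<close> is enough. Otherwise the new packing takes
  \<open>c z + 1\<close> copies of the arc into \<open>z\<close> and must have the size of \<open>c\<close> strictly below \<open>z\<close>. There
  the starting point is \<open>d\<close>, whose arcs out of \<open>z\<close> are few because \<open>d z\<close> is large; it is
  either shrunk or, with the roles of \<open>c\<close> and \<open>d\<close> exchanged, enlarged by the induction
  hypothesis. Enlarging costs at most \<open>d z - c z - 1\<close> copies of \<open>z\<close>, and at least as many are
  saved by lowering \<open>d z\<close> to \<open>c z + 1\<close>.\<close>
lemma augmentable:
  assumes pos: "\<And>y. y \<in> V \<Longrightarrow> 1 \<le> w y" and "z \<in> V"
  shows "augmentable w m z"
proof -
  have "wf (E\<inverse>)" using finite_E acyc by (rule finite_acyclic_wf_converse)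
  then show ?thesis using \<open>z \<in> V\<close>
  proof (induction z rule: wf_induct_rule)
    case (less z)
    let ?Z = "E `` {z}" and ?U = "below_set (E `` {z})"
    have aug: "\<And>u. u \<in> ?Z \<Longrightarrow> augmentable w m u" using less arcs_sub by auto
    have finU: "finite ?U" by (simp add: finite_below_set finite_children)
    have sum_z: "sum f (below z) = f z + sum f ?U" for f :: "'v \<Rightarrow> nat"
      unfolding below_eq[of z] using finU not_below_children by simp
    show ?case unfolding augmentable_def
    proof (intro allI impI)
      fix c d
      assume c: "packs E w (below z) m c" and d: "packs E w (below z) m d"
        and lt: "sum c (below z) < sum d (below z)"
      show "\<exists>e. packs E w (below z) m e \<and> sum e (below z) = Suc (sum c (below z)) \<and> e z \<le> Suc (c z)"
      proof (cases "d z \<le> Suc (c z)")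
        case True
        obtain e where "\<And>y. e y \<le> d y" "sum e (below z) = Suc (sum c (below z))"
          using shrink_to_sum[OF finite_below, of "Suc (sum c (below z))" d z] lt by auto
        then show ?thesis using True packs_mono[OF d] by (meson order_trans)
      next
        case False
        have U: "?U \<subseteq> below z" unfolding below_eq[of z] by blast
        have cU: "packs E w ?U m c" and dU: "packs E w ?U m d"
          using packs_subset U c d by blast+
        have dz: "w z * d z + sum d ?Z \<le> m z"
          using d self_below by (auto simp: packs_def)
        have "\<exists>e. packs E w ?U m e \<and> sum e ?U = sum c ?U \<and> w z * Suc (c z) + sum e ?Z \<le> m z"
        proof (cases "sum c ?U \<le> sum d ?U")
          case True
          obtain e where e: "\<And>y. e y \<le> d y" "sum e ?U = sum c ?U"
            using shrink_to_sum[OF finU True] by blast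
          have "w z * Suc (c z) + sum e ?Z \<le> w z * d z + sum d ?Z"
            using False e(1) by (intro add_mono mult_le_mono sum_mono) auto
          then show ?thesis using e packs_mono[OF dU] dz by (meson order_trans)
        next
          case gt: False
          then have "sum d ?U \<le> sum c ?U" by simp
          from augment_forest[OF finite_children siblings_disjoint[of _ z] aug dU cU this]
          obtain e where e: "packs E w ?U m e" "sum e ?U = sum c ?U"
            "sum e ?Z + sum d ?U \<le> sum d ?Z + sum c ?U" by blast
          obtain k where k: "d z = Suc (c z) + k" using False less_imp_Suc_add by (metis not_le_imp_less add_Suc_shift add_Suc)
          have "sum c ?U \<le> sum d ?U + k" using lt k unfolding sum_z by simp
          then have "sum e ?Z \<le> sum d ?Z + k" using e(3) by simp
          moreover have "k \<le> w z * k"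
            using mult_le_mono1[OF pos[OF less.prems], of k] by linarith
          moreover have "w z * d z = w z * Suc (c z) + w z * k"
            unfolding k by (rule distrib_left)
          ultimately have "w z * Suc (c z) + sum e ?Z \<le> w z * d z + sum d ?Z" by linarith
          then show ?thesis using e dz by (meson order_trans)
        qed
        then obtain e where e: "packs E w ?U m e" "sum e ?U = sum c ?U"
          "w z * Suc (c z) + sum e ?Z \<le> m z" by blast
        let ?e = "e(z := Suc (c z))"
        have zU: "z \<notin> ?U" by (rule not_below_children)
        have zZ: "z \<notin> ?Z" using zU self_below by (auto simp: below_set_def)
        have "packs E w ?U m ?e"
          using packs_cong[of ?U ?e e E w m] e(1) zU children_below_set by (metis fun_upd_apply)
        moreover have "sum ?e ?Z = sum e ?Z" using zZ by (intro sum.cong) auto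
        ultimately have "packs E w (below z) m ?e"
          unfolding below_eq[of z] using e(3) by (simp add: packs_def)
        moreover have "sum ?e ?U = sum e ?U" using zU by (intro sum.cong) auto
        ultimately show ?thesis using e(2) sum_z by (intro exI[of _ ?e]) auto
      qed
    qed
  qed
qed

end

locale planted_arborescence = arborescence V E x0
  for V :: "'v set" and E and x0 +
  fixes x1 :: 'v
  assumes root_child: "E `` {x0} = {x1}"
begin

lemma V_eq: "V = insert x0 (insert x1 (below_set (E `` {x1})))"
proof -
  have V: "V = below x0"
  proof
    show "below x0 \<subseteq> V"
      using arcs_sub root_in by (auto simp: below_def elim: rtranclE)
    have wf: "wf E" using finite_acyclic_wf[OF finite_E acyc] .
    have "y \<in> V \<longrightarrow> y \<in> below x0" for y
      using wf
    proof (induction y rule: wf_induct_rule)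
      case (less y)
      show ?case
      proof (cases "y = x0")
        case False
        show ?thesis
        proof
          assume "y \<in> V"
          then obtain x where "(x, y) \<in> E" using has_parent False by blast
          then show "y \<in> below x0" using less arcs_sub by (auto simp: below_def intro: rtrancl_into_rtrancl)
        qed
      qed (simp add: self_below)
    qed
    then show "V \<subseteq> below x0" by blast
  qed
  show ?thesis using V below_eq[of x0] below_eq[of x1] by (simp add: root_child below_set_def)
qed

lemma child_ne_root: "x1 \<noteq> x0"
  using root_child no_parent_root by blast

text \<open>The combinatorial core of the theorem: \<open>c\<close> may overspend the root \<open>x0\<close> and \<open>d\<close> its child
  \<open>x1\<close>. If \<open>c\<close> does overspend \<open>x0\<close>, it uses more copies of the arc \<open>(x0, x1)\<close> than \<open>d\<close>. The
  new packing takes the number of copies from \<open>d\<close> and makes up for the missing arcs by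
  augmenting \<open>c\<close> below \<open>x1\<close> to the size of \<open>d\<close>; every added arc costs at most one copy of
  \<open>x1\<close>, and every arc \<open>(x0, x1)\<close> given up frees at least one.\<close>
lemma saturations_meet:
  assumes pos: "\<And>y. y \<in> V \<Longrightarrow> 1 \<le> w y"
    and c: "packs E w V (m(x0 := m x0 + a)) c" "c x0 = 0" "sum c V = s"
    and d: "packs E w V (m(x1 := m x1 + b)) d" "d x0 = 0" "sum d V = s"
  obtains e where "packs E w V m e" and "e x0 = 0" and "sum e V = s"
proof -
  let ?Z = "E `` {x1}" let ?U = "below_set ?Z"
  have x1V: "x1 \<in> V" by (subst V_eq) simp
  have x1U: "x1 \<notin> ?U" by (rule not_below_children)
  have x0U: "x0 \<notin> ?U"
    using no_parent_root by (auto simp: below_set_def below_def elim: rtranclE)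
  have finU: "finite ?U" by (simp add: finite_below_set finite_children)
  have packs_V: "packs E w V n f \<longleftrightarrow> w x0 * f x0 + f x1 \<le> n x0 \<and>
      w x1 * f x1 + sum f ?Z \<le> n x1 \<and> packs E w ?U n f" for n f
    by (subst V_eq) (simp add: packs_def root_child)
  have sum_V: "sum f V = f x0 + f x1 + sum f ?U" for f :: "'v \<Rightarrow> nat"
    by (subst V_eq) (use finU x0U x1U child_ne_root in simp)
  have packs_U: "packs E w ?U (m(x := k)) f \<longleftrightarrow> packs E w ?U m f" if "x \<notin> ?U" for x k f
    using that by (auto simp: packs_def)
  have c': "c x1 \<le> m x0 + a" "w x1 * c x1 + sum c ?Z \<le> m x1" "packs E w ?U m c"
    using c child_ne_root by (auto simp: packs_V packs_U[OF x0U])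
  have d': "d x1 \<le> m x0" "packs E w ?U m d"
    using d child_ne_root by (auto simp: packs_V packs_U[OF x1U])
  show thesis
  proof (cases "c x1 \<le> m x0")
    case True
    then have "packs E w V m c" using c' c(2) by (simp add: packs_V)
    then show thesis using c that by blast
  next
    case False
    then obtain k where k: "c x1 = d x1 + k" using d'(1) by (metis le_add_diff_inverse nat_le_linear order_trans)
    have sums: "sum d ?U = sum c ?U + k" using c(2,3) d(2,3) k by (simp add: sum_V)
    then have "sum c ?U \<le> sum d ?U" by simp
    have aug: "\<And>z. z \<in> ?Z \<Longrightarrow> augmentable w m z" using augmentable pos arcs_sub by blast
    from augment_forest[OF finite_children siblings_disjoint[of _ x1] aug c'(3) d'(2) \<open>sum c ?U \<le> sum d ?U\<close>]
    obtain e where e: "packs E w ?U m e" "sum e ?U = sum d ?U"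
      "sum e ?Z + sum c ?U \<le> sum c ?Z + sum d ?U" by blast
    \<comment> \<open>\<open>e\<close> is controlled only below \<open>x1\<close>; its values at \<open>x0\<close> and \<open>x1\<close> are arbitrary.\<close>
    let ?e = "e(x0 := 0, x1 := d x1)"
    have onU: "?e y = e y" if "y \<in> ?U" for y using x0U x1U that by auto
    have ZU: "?Z \<subseteq> ?U" using self_below by (auto simp: below_set_def)
    have "sum ?e ?Z = sum e ?Z" by (rule sum.cong[OF refl]) (use onU ZU in blast)
    also have "\<dots> \<le> sum c ?Z + k" using e(3) sums by simp
    finally have "w x1 * d x1 + sum ?e ?Z \<le> w x1 * d x1 + sum c ?Z + w x1 * k"
      using mult_le_mono1[OF pos[OF x1V], of k] by linarith
    also have "\<dots> \<le> m x1" using c'(2) k by (simp add: algebra_simps)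
    finally have "w x1 * d x1 + sum ?e ?Z \<le> m x1" .
    moreover have "packs E w ?U m ?e"
      using packs_cong[of ?U ?e e E w m] e(1) onU children_below_set by blast
    ultimately have "packs E w V m ?e" using d'(1) child_ne_root by (simp add: packs_V)
    moreover have "sum ?e ?U = sum e ?U" using onU by (intro sum.cong) auto
    then have "sum ?e V = s" using e(2) d(2,3) child_ne_root by (simp add: sum_V)
    ultimately show thesis using that[of ?e] child_ne_root by simp
  qed
qed

end

section \<open>Localization and contraction\<close>

lemma UN_pairs_const:
  assumes "X \<noteq> {}" and "Y \<noteq> {}"
    and "\<And>a s b t. (a, s) \<in> X \<Longrightarrow> (b, t) \<in> Y \<Longrightarrow> F a s b t = C"
  shows "(\<Union>(a, s)\<in>X. \<Union>(b, t)\<in>Y. F a s b t) = C"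
  using assms by force

text \<open>The ideal generated by a set is an intersection of ideals, and an ideal presupposes a ring.
  To bound an extended ideal from above, the localization has therefore to be shown to be a
  ring.\<close>
locale mult_submonoid = cring R for R (structure) +
  fixes S
  assumes S_sub: "S \<subseteq> carrier R" and one_S: "\<one> \<in> S"
    and mult_S: "\<And>s t. s \<in> S \<Longrightarrow> t \<in> S \<Longrightarrow> s \<otimes> t \<in> S"
begin

lemma S_carr: "s \<in> S \<Longrightarrow> s \<in> carrier R" using S_sub by auto

lemma rel_refl: "a \<in> carrier R \<Longrightarrow> s \<in> S \<Longrightarrow> ((a, s), (a, s)) \<in> fraction_rel R S"
  using one_S by (auto simp: fraction_rel_def)

lemma rel_sym: "(X, Y) \<in> fraction_rel R S \<Longrightarrow> (Y, X) \<in> fraction_rel R S"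
  by (force simp: fraction_rel_def)

lemma rel_trans:
  assumes "(X, Y) \<in> fraction_rel R S" and "(Y, Z) \<in> fraction_rel R S"
  shows "(X, Z) \<in> fraction_rel R S"
proof -
  obtain a s b t c r where X: "X = (a, s)" and Y: "Y = (b, t)" and Z: "Z = (c, r)"
    by (metis surj_pair)
  obtain u v where *: "a \<in> carrier R" "b \<in> carrier R" "c \<in> carrier R" "s \<in> S" "t \<in> S" "r \<in> S"
    "u \<in> S" "v \<in> S" "u \<otimes> (a \<otimes> t) = u \<otimes> (b \<otimes> s)" "v \<otimes> (b \<otimes> r) = v \<otimes> (c \<otimes> t)"
    using assms by (auto simp: fraction_rel_def X Y Z)
  note carr = *(1-3) *(4-8)[THEN S_carr]
  have "(u \<otimes> v \<otimes> t) \<otimes> (a \<otimes> r) = (u \<otimes> (a \<otimes> t)) \<otimes> (v \<otimes> r)" using carr by (simp add: m_ac l_distr r_distr)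
  also have "\<dots> = (v \<otimes> (b \<otimes> r)) \<otimes> (u \<otimes> s)" unfolding *(9) using carr by (simp add: m_ac l_distr r_distr)
  also have "\<dots> = (u \<otimes> v \<otimes> t) \<otimes> (c \<otimes> s)" unfolding *(10) using carr by (simp add: m_ac l_distr r_distr)
  finally have "\<exists>x\<in>S. x \<otimes> (a \<otimes> r) = x \<otimes> (c \<otimes> s)" using * mult_S by blast
  then show ?thesis using * by (auto simp: fraction_rel_def X Z)
qed

lemma equiv_rel: "equiv (carrier R \<times> S) (fraction_rel R S)"
proof (rule equivI)
  show "fraction_rel R S \<subseteq> (carrier R \<times> S) \<times> (carrier R \<times> S)" by (auto simp: fraction_rel_def)
  show "refl_on (carrier R \<times> S) (fraction_rel R S)" by (auto simp: refl_on_def rel_refl)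
  show "sym (fraction_rel R S)" using rel_sym by (rule symI)
  show "trans (fraction_rel R S)" using rel_trans by (rule transI)
qed

lemma fraction_eq_iff:
  assumes "a \<in> carrier R" "s \<in> S" "b \<in> carrier R" "t \<in> S"
  shows "fraction R S a s = fraction R S b t \<longleftrightarrow> (\<exists>u\<in>S. u \<otimes> (a \<otimes> t) = u \<otimes> (b \<otimes> s))"
proof -
  have "fraction R S a s = fraction R S b t \<longleftrightarrow> ((a, s), (b, t)) \<in> fraction_rel R S"
    unfolding fraction_def using eq_equiv_class_iff[OF equiv_rel] assms by auto
  then show ?thesis using assms by (simp add: fraction_rel_def)
qed

lemma carrier_localization:
  "carrier (localization R S) = {fraction R S a s |a s. a \<in> carrier R \<and> s \<in> S}"
  by (auto simp: localization_def quotient_def fraction_def)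

lemma in_fraction:
  "(b, t) \<in> fraction R S a s \<Longrightarrow> ((a, s), (b, t)) \<in> fraction_rel R S"
  by (simp add: fraction_def)

lemma self_in_fraction:
  "a \<in> carrier R \<Longrightarrow> s \<in> S \<Longrightarrow> (a, s) \<in> fraction R S a s"
  by (simp add: fraction_def rel_refl)

lemma mult_localization:
  assumes "a \<in> carrier R" "s \<in> S" "b \<in> carrier R" "t \<in> S"
  shows "fraction R S a s \<otimes>\<^bsub>localization R S\<^esub> fraction R S b t = fraction R S (a \<otimes> b) (s \<otimes> t)"
proof -
  have "fraction R S (a' \<otimes> b') (s' \<otimes> t') = fraction R S (a \<otimes> b) (s \<otimes> t)"
    if 1: "(a', s') \<in> fraction R S a s" and 2: "(b', t') \<in> fraction R S b t" for a' s' b' t'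
  proof -
    obtain u v where *: "a' \<in> carrier R" "s' \<in> S" "u \<in> S" "u \<otimes> (a \<otimes> s') = u \<otimes> (a' \<otimes> s)"
      "b' \<in> carrier R" "t' \<in> S" "v \<in> S" "v \<otimes> (b \<otimes> t') = v \<otimes> (b' \<otimes> t)"
      using 1[THEN in_fraction] 2[THEN in_fraction] by (auto simp: fraction_rel_def)
    note carr = assms(1,3) *(1,5) assms(2,4)[THEN S_carr] *(2,3,6,7)[THEN S_carr]
    have "(u \<otimes> v) \<otimes> ((a' \<otimes> b') \<otimes> (s \<otimes> t)) = (u \<otimes> (a' \<otimes> s)) \<otimes> (v \<otimes> (b' \<otimes> t))"
      using carr by (simp add: m_ac l_distr r_distr)
    also have "\<dots> = (u \<otimes> v) \<otimes> ((a \<otimes> b) \<otimes> (s' \<otimes> t'))"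
      unfolding *(4,8)[symmetric] using carr by (simp add: m_ac l_distr r_distr)
    finally show ?thesis
      using carr assms * mult_S by (intro fraction_eq_iff[THEN iffD2] bexI[of _ "u \<otimes> v"]) auto
  qed
  moreover have "fraction R S a s \<noteq> {}" "fraction R S b t \<noteq> {}"
    using self_in_fraction[OF assms(1,2)] self_in_fraction[OF assms(3,4)] by auto
  ultimately show ?thesis
    unfolding localization_def ring.simps monoid.simps by (intro UN_pairs_const)
qed

lemma add_localization:
  assumes "a \<in> carrier R" "s \<in> S" "b \<in> carrier R" "t \<in> S"
  shows "fraction R S a s \<oplus>\<^bsub>localization R S\<^esub> fraction R S b t =
    fraction R S (a \<otimes> t \<oplus> b \<otimes> s) (s \<otimes> t)"
proof -
  have "fraction R S (a' \<otimes> t' \<oplus> b' \<otimes> s') (s' \<otimes> t') = fraction R S (a \<otimes> t \<oplus> b \<otimes> s) (s \<otimes> t)"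
    if 1: "(a', s') \<in> fraction R S a s" and 2: "(b', t') \<in> fraction R S b t" for a' s' b' t'
  proof -
    obtain u v where *: "a' \<in> carrier R" "s' \<in> S" "u \<in> S" "u \<otimes> (a \<otimes> s') = u \<otimes> (a' \<otimes> s)"
      "b' \<in> carrier R" "t' \<in> S" "v \<in> S" "v \<otimes> (b \<otimes> t') = v \<otimes> (b' \<otimes> t)"
      using 1[THEN in_fraction] 2[THEN in_fraction] by (auto simp: fraction_rel_def)
    note carr = assms(1,3) *(1,5) assms(2,4)[THEN S_carr] *(2,3,6,7)[THEN S_carr]
    have "(u \<otimes> v) \<otimes> ((a' \<otimes> t' \<oplus> b' \<otimes> s') \<otimes> (s \<otimes> t)) =
        (u \<otimes> (a' \<otimes> s)) \<otimes> (v \<otimes> t' \<otimes> t) \<oplus> (v \<otimes> (b' \<otimes> t)) \<otimes> (u \<otimes> s' \<otimes> s)"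
      using carr by (simp add: m_ac l_distr r_distr)
    also have "\<dots> = (u \<otimes> v) \<otimes> ((a \<otimes> t \<oplus> b \<otimes> s) \<otimes> (s' \<otimes> t'))"
      unfolding *(4,8)[symmetric] using carr by (simp add: m_ac l_distr r_distr)
    finally show ?thesis
      using carr assms * mult_S by (intro fraction_eq_iff[THEN iffD2] bexI[of _ "u \<otimes> v"]) auto
  qed
  moreover have "fraction R S a s \<noteq> {}" "fraction R S b t \<noteq> {}"
    using self_in_fraction[OF assms(1,2)] self_in_fraction[OF assms(3,4)] by auto
  ultimately show ?thesis
    unfolding localization_def ring.simps monoid.simps by (intro UN_pairs_const)
qed

lemma one_localization: "\<one>\<^bsub>localization R S\<^esub> = fraction R S \<one> \<one>"
  and zero_localization: "\<zero>\<^bsub>localization R S\<^esub> = fraction R S \<zero> \<one>"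
  by (simp_all add: localization_def)

lemma fraction_eqI:
  assumes "a \<in> carrier R" "s \<in> S" "b \<in> carrier R" "t \<in> S" and "a \<otimes> t = b \<otimes> s"
  shows "fraction R S a s = fraction R S b t"
  using assms one_S fraction_eq_iff by auto

lemma localization_cases:
  assumes "X \<in> carrier (localization R S)"
  obtains a s where "X = fraction R S a s" "a \<in> carrier R" "s \<in> S" "s \<in> carrier R"
  using assms S_carr by (auto simp: carrier_localization)

lemma fraction_closed:
  "a \<in> carrier R \<Longrightarrow> s \<in> S \<Longrightarrow> fraction R S a s \<in> carrier (localization R S)"
  by (auto simp: carrier_localization)

lemmas localization_simps = mult_localization add_localization one_localization zero_localization
  fraction_closed mult_S one_S

lemma cring_localization: "cring (localization R S)"
proof (rule cringI)
  show "abelian_group (localization R S)"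
  proof (rule abelian_groupI)
    fix X Y Z
    assume X: "X \<in> carrier (localization R S)"
    then obtain a s where x: "X = fraction R S a s" "a \<in> carrier R" "s \<in> S" "s \<in> carrier R"
      by (rule localization_cases)
    have "\<ominus> a \<otimes> s \<oplus> a \<otimes> s = \<zero>" using x by (simp add: l_minus l_neg)
    then have "fraction R S (\<ominus> a) s \<oplus>\<^bsub>localization R S\<^esub> X = \<zero>\<^bsub>localization R S\<^esub>"
      using x by (simp add: localization_simps) (rule fraction_eqI; simp add: mult_S one_S)
    then show "\<exists>Y\<in>carrier (localization R S). Y \<oplus>\<^bsub>localization R S\<^esub> X = \<zero>\<^bsub>localization R S\<^esub>"
      using x fraction_closed by blast
    show "\<zero>\<^bsub>localization R S\<^esub> \<oplus>\<^bsub>localization R S\<^esub> X = X"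
      using x by (simp add: localization_simps)
    assume Y: "Y \<in> carrier (localization R S)"
    then obtain b t where y: "Y = fraction R S b t" "b \<in> carrier R" "t \<in> S" "t \<in> carrier R"
      by (rule localization_cases)
    show "X \<oplus>\<^bsub>localization R S\<^esub> Y \<in> carrier (localization R S)"
      using x y by (simp add: localization_simps)
    show "X \<oplus>\<^bsub>localization R S\<^esub> Y = Y \<oplus>\<^bsub>localization R S\<^esub> X"
      using x y by (simp add: localization_simps) (rule fraction_eqI; simp add: mult_S one_S l_distr r_distr m_ac a_ac l_minus l_neg)
    assume Z: "Z \<in> carrier (localization R S)"
    then obtain c r where z: "Z = fraction R S c r" "c \<in> carrier R" "r \<in> S" "r \<in> carrier R"
      by (rule localization_cases)
    show "X \<oplus>\<^bsub>localization R S\<^esub> Y \<oplus>\<^bsub>localization R S\<^esub> Z =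
        X \<oplus>\<^bsub>localization R S\<^esub> (Y \<oplus>\<^bsub>localization R S\<^esub> Z)"
      using x y z by (simp add: localization_simps) (rule fraction_eqI; simp add: mult_S one_S l_distr r_distr m_ac a_ac l_minus l_neg)
  qed (simp add: localization_simps)
  show "comm_monoid (localization R S)"
  proof (rule comm_monoidI)
    fix X Y Z
    assume X: "X \<in> carrier (localization R S)"
    then obtain a s where x: "X = fraction R S a s" "a \<in> carrier R" "s \<in> S" "s \<in> carrier R"
      by (rule localization_cases)
    show "\<one>\<^bsub>localization R S\<^esub> \<otimes>\<^bsub>localization R S\<^esub> X = X"
      using x by (simp add: localization_simps)
    assume Y: "Y \<in> carrier (localization R S)"
    then obtain b t where y: "Y = fraction R S b t" "b \<in> carrier R" "t \<in> S" "t \<in> carrier R"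
      by (rule localization_cases)
    show "X \<otimes>\<^bsub>localization R S\<^esub> Y \<in> carrier (localization R S)"
      using x y by (simp add: localization_simps)
    show "X \<otimes>\<^bsub>localization R S\<^esub> Y = Y \<otimes>\<^bsub>localization R S\<^esub> X"
      using x y by (simp add: localization_simps m_comm)
    assume Z: "Z \<in> carrier (localization R S)"
    then obtain c r where z: "Z = fraction R S c r" "c \<in> carrier R" "r \<in> S" "r \<in> carrier R"
      by (rule localization_cases)
    show "X \<otimes>\<^bsub>localization R S\<^esub> Y \<otimes>\<^bsub>localization R S\<^esub> Z =
        X \<otimes>\<^bsub>localization R S\<^esub> (Y \<otimes>\<^bsub>localization R S\<^esub> Z)"
      using x y z by (simp add: localization_simps m_assoc)
  qed (simp add: localization_simps)
next
  fix X Y Z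
  assume "X \<in> carrier (localization R S)" "Y \<in> carrier (localization R S)"
    "Z \<in> carrier (localization R S)"
  then obtain a s b t c r where x: "X = fraction R S a s" "a \<in> carrier R" "s \<in> S" "s \<in> carrier R"
    and y: "Y = fraction R S b t" "b \<in> carrier R" "t \<in> S" "t \<in> carrier R"
    and z: "Z = fraction R S c r" "c \<in> carrier R" "r \<in> S" "r \<in> carrier R"
    by (elim localization_cases)
  show "(X \<oplus>\<^bsub>localization R S\<^esub> Y) \<otimes>\<^bsub>localization R S\<^esub> Z =
      X \<otimes>\<^bsub>localization R S\<^esub> Z \<oplus>\<^bsub>localization R S\<^esub> Y \<otimes>\<^bsub>localization R S\<^esub> Z"
    using x y z by (simp add: localization_simps) (rule fraction_eqI; simp add: mult_S one_S l_distr r_distr m_ac a_ac l_minus l_neg)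
qed

text \<open>The fractions with numerator in \<open>J\<close> already form an ideal of the localization, by passing to
  common denominators.\<close>
lemma extension_ideal_fractions:
  assumes J: "ideal J R" and X: "X \<in> extension_ideal R S J"
  obtains a s where "a \<in> J" "s \<in> S" "X = fraction R S a s"
proof -
  interpret J: ideal J R by (rule J)
  interpret L: cring "localization R S" by (rule cring_localization)
  let ?K = "{fraction R S a s |a s. a \<in> J \<and> s \<in> S}"
  have add: "X \<oplus>\<^bsub>localization R S\<^esub> Y \<in> ?K" if XY: "X \<in> ?K" "Y \<in> ?K" for X Y
  proof -
    obtain a s b t where *: "a \<in> J" "s \<in> S" "X = fraction R S a s" "b \<in> J" "t \<in> S" "Y = fraction R S b t"
      using XY by blast
    then have "a \<otimes> t \<oplus> b \<otimes> s \<in> J" by (simp add: J.I_r_closed J.a_closed S_carr)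
    then show ?thesis using * mult_S by (auto simp: add_localization)
  qed
  have mult: "Y \<otimes>\<^bsub>localization R S\<^esub> X \<in> ?K"
    if X: "X \<in> ?K" and Y: "Y \<in> carrier (localization R S)" for X Y
  proof -
    obtain a s where *: "a \<in> J" "s \<in> S" "X = fraction R S a s" using X by blast
    obtain b t where "Y = fraction R S b t" "b \<in> carrier R" "t \<in> S"
      using Y by (rule localization_cases)
    moreover from this have "b \<otimes> a \<in> J" using * by (simp add: J.I_l_closed)
    ultimately show ?thesis using * mult_S by (force simp: mult_localization)
  qed
  have sub: "?K \<subseteq> carrier (localization R S)" using fraction_closed J.Icarr by blast
  have "ideal ?K (localization R S)"
  proof (rule idealI)
    show "subgroup ?K (add_monoid (localization R S))"
    proof (rule L.add.subgroupI)
      show "?K \<noteq> {}" using J.zero_closed one_S by blast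
      fix X assume X: "X \<in> ?K"
      then have "X \<in> carrier (localization R S)" using sub by blast
      then have "\<ominus>\<^bsub>localization R S\<^esub> X = (\<ominus>\<^bsub>localization R S\<^esub> \<one>\<^bsub>localization R S\<^esub>) \<otimes>\<^bsub>localization R S\<^esub> X"
        by (simp add: L.l_minus)
      then show "\<ominus>\<^bsub>localization R S\<^esub> X \<in> ?K" using mult[OF X] by simp
    qed (use add sub in auto)
    fix X Y assume *: "X \<in> ?K" "Y \<in> carrier (localization R S)"
    then show "Y \<otimes>\<^bsub>localization R S\<^esub> X \<in> ?K" by (rule mult)
    moreover have "X \<in> carrier (localization R S)" using *(1) sub by blast
    ultimately show "X \<otimes>\<^bsub>localization R S\<^esub> Y \<in> ?K" using L.m_comm[OF _ *(2)] by simp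
  qed (rule L.ring_axioms)
  moreover have "(\<lambda>a. fraction R S a \<one>) ` J \<subseteq> ?K" using one_S by auto
  ultimately have "extension_ideal R S J \<subseteq> ?K"
    unfolding extension_ideal_def by (rule L.genideal_minimal)
  then show thesis using X that by blast
qed

end

text \<open>Clearing denominators: the elements of \<open>J R\<^sub>P \<inter> R\<close> are carried into \<open>J\<close> by some multiplier
  outside \<open>P\<close>.\<close>
lemma local_contraction_colon:
  assumes "primeideal P R" and "ideal J R" and r: "r \<in> local_contraction R P J"
  obtains u where "u \<in> carrier R - P" and "u \<otimes>\<^bsub>R\<^esub> r \<in> J"
proof -
  interpret P: primeideal P R by fact
  interpret J: ideal J R by fact
  have "\<one>\<^bsub>R\<^esub> \<notin> P" using P.one_imp_carrier P.I_notcarr by blast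
  then interpret mult_submonoid R "carrier R - P"
    by unfold_locales (use P.I_prime in auto)
  have rc: "r \<in> carrier R" using r by (simp add: local_contraction_def)
  obtain a s where a: "a \<in> J" "s \<in> carrier R - P"
    "fraction R (carrier R - P) r \<one>\<^bsub>R\<^esub> = fraction R (carrier R - P) a s"
    using extension_ideal_fractions[OF \<open>ideal J R\<close>] r unfolding local_contraction_def by blast
  then obtain u where u: "u \<in> carrier R - P" "u \<otimes>\<^bsub>R\<^esub> (r \<otimes>\<^bsub>R\<^esub> s) = u \<otimes>\<^bsub>R\<^esub> (a \<otimes>\<^bsub>R\<^esub> \<one>\<^bsub>R\<^esub>)"
    using fraction_eq_iff[OF rc one_S J.Icarr[OF a(1)] a(2)] by auto
  have "(u \<otimes>\<^bsub>R\<^esub> s) \<otimes>\<^bsub>R\<^esub> r = u \<otimes>\<^bsub>R\<^esub> (r \<otimes>\<^bsub>R\<^esub> s)" using u(1) a(2) rc by (simp add: P.m_ac)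
  also have "\<dots> \<in> J" using u a by (simp add: J.I_l_closed J.Icarr)
  finally show thesis using that mult_S u(1) a(2) by blast
qed

section \<open>Monomial ideals\<close>

definition monomials :: "'v set \<Rightarrow> ('v \<Rightarrow>\<^sub>0 nat) set" where
  "monomials V = {m. Poly_Mapping.keys m \<subseteq> V}"

text \<open>The linear span of a set of monomials. It is an ideal of the polynomial ring in \<open>V\<close> if the
  set is closed under multiplication by monomials (\<open>absorbing\<close>, below), and every monomial
  ideal has this form.\<close>
definition mspan :: "('v \<Rightarrow>\<^sub>0 nat) set \<Rightarrow> ('v, 'k::comm_ring_1) mpoly set" where
  "mspan A = {p. Poly_Mapping.keys p \<subseteq> A}"

definition absorbing :: "'v set \<Rightarrow> ('v \<Rightarrow>\<^sub>0 nat) set \<Rightarrow> bool" where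
  "absorbing V A \<longleftrightarrow> A \<subseteq> monomials V \<and> (\<forall>m\<in>A. \<forall>n\<in>monomials V. m + n \<in> A)"

lemma keys_add_nat: "Poly_Mapping.keys (m + n :: 'v \<Rightarrow>\<^sub>0 nat) = Poly_Mapping.keys m \<union> Poly_Mapping.keys n"
  by (auto simp: in_keys_iff lookup_add)

lemma monomials_add: "m + n \<in> monomials V \<longleftrightarrow> m \<in> monomials V \<and> n \<in> monomials V"
  by (simp add: monomials_def keys_add_nat)

lemma monomials_zero: "0 \<in> monomials V"
  by (simp add: monomials_def)

lemma monomials_single: "x \<in> V \<Longrightarrow> Poly_Mapping.single x n \<in> monomials V"
  by (simp add: monomials_def)

lemma absorbing_generated:
  assumes "T \<subseteq> monomials V"
  shows "absorbing V {t + n |t n. t \<in> T \<and> n \<in> monomials V}" (is "absorbing V ?A")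
  unfolding absorbing_def
proof (intro conjI ballI)
  show "?A \<subseteq> monomials V" using assms by (auto simp: monomials_add)
  fix m k assume "m \<in> ?A" "k \<in> monomials V"
  then obtain t n where "m = t + n" "t \<in> T" "n + k \<in> monomials V" by (auto simp: monomials_add)
  then show "m + k \<in> ?A" by (auto simp: add.assoc)
qed

lemma poly_ring_simps:
  "carrier (poly_ring V) = mspan (monomials V)"
  "monoid.mult (poly_ring V) = (*)" "monoid.one (poly_ring V) = 1"
  "ring.zero (poly_ring V) = 0" "ring.add (poly_ring V) = (+)"
  by (auto simp: poly_ring_def mspan_def monomials_def)

lemma mspan_zero: "0 \<in> mspan A"
  by (simp add: mspan_def)

lemma mspan_add: "p \<in> mspan A \<Longrightarrow> q \<in> mspan A \<Longrightarrow> p + q \<in> mspan A"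
  using keys_add[of p q] by (auto simp: mspan_def)

lemma mspan_uminus: "p \<in> mspan A \<Longrightarrow> - p \<in> mspan A"
  by (auto simp: mspan_def in_keys_iff)

lemma mspan_single: "m \<in> A \<Longrightarrow> Poly_Mapping.single m a \<in> mspan A"
  by (simp add: mspan_def)

lemma mspan_mult:
  assumes "p \<in> mspan A" and "q \<in> mspan B" and "\<And>a b. a \<in> A \<Longrightarrow> b \<in> B \<Longrightarrow> a + b \<in> C"
  shows "p * q \<in> mspan C"
  using keys_mult[of p q] assms unfolding mspan_def by blast

lemma mspan_mono: "A \<subseteq> B \<Longrightarrow> mspan A \<subseteq> mspan B"
  by (auto simp: mspan_def)

lemma sum_of_monomials:
  "p = (\<Sum>m\<in>Poly_Mapping.keys p. Poly_Mapping.single m (Poly_Mapping.lookup p m))"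
proof (rule poly_mapping_eqI)
  fix k
  have "(\<Sum>m\<in>Poly_Mapping.keys p. Poly_Mapping.lookup (Poly_Mapping.single m (Poly_Mapping.lookup p m)) k)
      = (\<Sum>m\<in>Poly_Mapping.keys p. if k = m then Poly_Mapping.lookup p m else 0)"
    by (intro sum.cong) (auto simp: lookup_single when_def)
  also have "\<dots> = Poly_Mapping.lookup p k" by (auto simp: in_keys_iff)
  finally show "Poly_Mapping.lookup p k = Poly_Mapping.lookup
      (\<Sum>m\<in>Poly_Mapping.keys p. Poly_Mapping.single m (Poly_Mapping.lookup p m)) k"
    by (simp add: lookup_sum)
qed

lemma cring_poly_ring: "cring (poly_ring V :: ('v, 'k::comm_ring_1) mpoly ring)"
proof (rule cringI)
  show "abelian_group (poly_ring V :: ('v, 'k) mpoly ring)"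
  proof (rule abelian_groupI)
    fix p :: "('v, 'k) mpoly" assume "p \<in> carrier (poly_ring V)"
    then have "- p \<in> carrier (poly_ring V)" "- p + p = 0" by (simp_all add: poly_ring_simps mspan_uminus)
    then show "\<exists>q\<in>carrier (poly_ring V). q \<oplus>\<^bsub>poly_ring V\<^esub> p = \<zero>\<^bsub>poly_ring V\<^esub>"
      unfolding poly_ring_simps by blast
  qed (auto simp: poly_ring_simps mspan_add mspan_zero add.assoc add.commute)
  show "comm_monoid (poly_ring V :: ('v, 'k) mpoly ring)"
    by (rule comm_monoidI)
      (auto simp: poly_ring_simps mult.assoc mult.commute monomials_add
        mspan_single[OF monomials_zero, of 1, simplified] intro: mspan_mult)
qed (simp add: poly_ring_simps distrib_right)

lemma ideal_mspan:
  assumes "absorbing V A"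
  shows "ideal (mspan A :: ('v, 'k::comm_ring_1) mpoly set) (poly_ring V)"
proof -
  interpret cring "poly_ring V :: ('v, 'k) mpoly ring" by (rule cring_poly_ring)
  have sub: "(mspan A :: ('v, 'k) mpoly set) \<subseteq> carrier (poly_ring V)"
    using assms mspan_mono by (auto simp: poly_ring_simps absorbing_def)
  have mult: "p * q \<in> mspan A" if "p \<in> mspan A" "q \<in> mspan (monomials V)" for p q :: "('v, 'k) mpoly"
    using that assms by (auto simp: absorbing_def intro: mspan_mult)
  show ?thesis
  proof (rule idealI)
    show "subgroup (mspan A :: ('v, 'k) mpoly set) (add_monoid (poly_ring V))"
    proof (rule add.subgroupI)
      fix p :: "('v, 'k) mpoly" assume p: "p \<in> mspan A"
      have "\<ominus>\<^bsub>poly_ring V\<^esub> p = - p"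
        using p sub by (intro minus_equality) (auto simp: poly_ring_simps mspan_uminus)
      then show "\<ominus>\<^bsub>poly_ring V\<^esub> p \<in> mspan A" using p by (simp add: mspan_uminus)
    next
      show "(mspan A :: ('v, 'k) mpoly set) \<noteq> {}" using mspan_zero by blast
    qed (use sub mspan_add in \<open>auto simp: poly_ring_simps\<close>)
  next
    fix p q :: "('v, 'k) mpoly"
    assume "p \<in> mspan A" "q \<in> carrier (poly_ring V)"
    then have "p * q \<in> mspan A" using mult by (simp add: poly_ring_simps)
    then show "q \<otimes>\<^bsub>poly_ring V\<^esub> p \<in> mspan A" "p \<otimes>\<^bsub>poly_ring V\<^esub> q \<in> mspan A"
      by (simp_all add: poly_ring_simps mult.commute)
  qed (rule ring_axioms)
qed

lemma sum_in_set:
  assumes "0 \<in> S" and "\<And>a b. a \<in> S \<Longrightarrow> b \<in> S \<Longrightarrow> a + b \<in> S" and "\<And>i. i \<in> I \<Longrightarrow> f i \<in> S"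
  shows "sum f I \<in> S"
  using assms(3) by (induction I rule: infinite_finite_induct) (auto intro: assms)

lemma genideal_monomials:
  assumes "T \<subseteq> monomials V"
  shows "Idl\<^bsub>poly_ring V\<^esub> ((\<lambda>t. Poly_Mapping.single t 1) ` T) =
    (mspan {t + n |t n. t \<in> T \<and> n \<in> monomials V} :: ('v, 'k::comm_ring_1) mpoly set)"
    (is "?I = mspan ?A")
proof
  interpret cring "poly_ring V :: ('v, 'k) mpoly ring" by (rule cring_poly_ring)
  have "absorbing V ?A" using assms by (rule absorbing_generated)
  then have "ideal (mspan ?A :: ('v, 'k) mpoly set) (poly_ring V)" by (rule ideal_mspan)
  moreover have "(\<lambda>t. Poly_Mapping.single t 1) ` T \<subseteq> (mspan ?A :: ('v, 'k) mpoly set)"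
    using monomials_zero by (force intro: mspan_single)
  ultimately show "?I \<subseteq> mspan ?A" by (rule genideal_minimal)
  have gen: "(\<lambda>t. Poly_Mapping.single t 1 :: ('v, 'k) mpoly) ` T \<subseteq> carrier (poly_ring V)"
    using assms by (auto simp: poly_ring_simps intro: mspan_single)
  interpret I: ideal ?I "poly_ring V" using gen by (rule genideal_ideal)
  show "mspan ?A \<subseteq> ?I"
  proof
    fix p :: "('v, 'k) mpoly" assume p: "p \<in> mspan ?A"
    have summand: "Poly_Mapping.single m a \<in> ?I" if m: "m \<in> ?A" for m and a :: 'k
    proof -
      obtain t n where tn: "m = t + n" "t \<in> T" "n \<in> monomials V" using m by auto
      have "Poly_Mapping.single t 1 \<in> ?I" using genideal_self[OF gen] tn by blast
      moreover have "Poly_Mapping.single n a \<in> carrier (poly_ring V)"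
        using tn by (simp add: poly_ring_simps mspan_single)
      ultimately have "Poly_Mapping.single n a \<otimes>\<^bsub>poly_ring V\<^esub> Poly_Mapping.single t 1 \<in> ?I"
        by (rule I.I_l_closed)
      then show ?thesis by (simp add: poly_ring_simps mult_single tn add.commute)
    qed
    have zero: "0 \<in> ?I" and add: "\<And>a b. a \<in> ?I \<Longrightarrow> b \<in> ?I \<Longrightarrow> a + b \<in> ?I"
      using I.zero_closed I.a_closed by (simp_all add: poly_ring_simps)
    have "(\<Sum>m\<in>Poly_Mapping.keys p. Poly_Mapping.single m (Poly_Mapping.lookup p m)) \<in> ?I"
      using p by (intro sum_in_set[OF zero add] summand) (auto simp: mspan_def)
    then show "p \<in> ?I" by (simp flip: sum_of_monomials)
  qed
qed

lemma ideal_prod_mspan: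
  "ideal_prod (poly_ring V) (mspan A) (mspan B) =
    (mspan {a + b |a b. a \<in> A \<and> b \<in> B} :: ('v, 'k::comm_ring_1) mpoly set)" (is "?P = mspan ?C")
proof
  show "?P \<subseteq> mspan ?C"
  proof
    fix p assume "p \<in> ?P"
    then show "p \<in> mspan ?C"
      by induction (auto simp: poly_ring_simps intro: mspan_add mspan_mult)
  qed
  show "mspan ?C \<subseteq> ?P"
  proof
    fix p :: "('v, 'k) mpoly" assume p: "p \<in> mspan ?C"
    have prod: "a * b \<in> ?P" if "a \<in> mspan A" "b \<in> mspan B" for a b
      using ideal_prod.prod[OF that, of "poly_ring V"] by (simp add: poly_ring_simps)
    have zero: "0 \<in> ?P" using prod[OF mspan_zero mspan_zero] by simp
    have add: "a + b \<in> ?P" if "a \<in> ?P" "b \<in> ?P" for a b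
      using ideal_prod.sum[OF that] by (simp add: poly_ring_simps)
    have summand: "Poly_Mapping.single m c \<in> ?P" if m: "m \<in> ?C" for m and c :: 'k
    proof -
      obtain a b where ab: "m = a + b" "a \<in> A" "b \<in> B" using m by blast
      then show ?thesis
        using prod[OF mspan_single[OF ab(2), of c] mspan_single[OF ab(3), of 1]]
        by (simp add: mult_single)
    qed
    have "(\<Sum>m\<in>Poly_Mapping.keys p. Poly_Mapping.single m (Poly_Mapping.lookup p m)) \<in> ?P"
      using p by (intro sum_in_set[OF zero add] summand) (auto simp: mspan_def)
    then show "p \<in> ?P" by (simp flip: sum_of_monomials)
  qed
qed

text \<open>There is no cancellation in a coefficient of a product to which a single pair of terms
  contributes.\<close>
lemma lookup_mult_unique:
  fixes f g :: "('v \<Rightarrow>\<^sub>0 nat) \<Rightarrow>\<^sub>0 'k::comm_ring_1"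
  assumes "\<And>k' l'. k' \<in> Poly_Mapping.keys f \<Longrightarrow> l' \<in> Poly_Mapping.keys g \<Longrightarrow> k' + l' = k + l \<Longrightarrow> k' = k"
  shows "Poly_Mapping.lookup (f * g) (k + l) = Poly_Mapping.lookup f k * Poly_Mapping.lookup g l"
proof -
  let ?h = "\<lambda>k'. Poly_Mapping.lookup f k' * (\<Sum>l'. Poly_Mapping.lookup g l' when k + l = k' + l')"
  have "?h k' = (?h k' when k' = k)" for k'
  proof (cases "k' = k")
    case False
    have "?h k' = 0"
    proof (rule ccontr)
      assume "?h k' \<noteq> 0"
      then have f: "Poly_Mapping.lookup f k' \<noteq> 0"
        and "(\<Sum>l'. Poly_Mapping.lookup g l' when k + l = k' + l') \<noteq> 0"
        by (auto dest: mult_not_zero)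
      then obtain l' where "(Poly_Mapping.lookup g l' when k + l = k' + l') \<noteq> 0"
        by (elim Sum_any.not_neutral_obtains_not_neutral)
      then have "Poly_Mapping.lookup g l' \<noteq> 0" "k + l = k' + l'" by (auto simp: when_def split: if_splits)
      then show False using assms[of k' l'] f False by (simp add: in_keys_iff)
    qed
    then show ?thesis using False by simp
  qed simp
  then have "Poly_Mapping.lookup (f * g) (k + l) = (\<Sum>k'. ?h k' when k' = k)"
    unfolding lookup_mult by (rule Sum_any.cong)
  also have "\<dots> = ?h k" by simp
  also have "(\<Sum>l'. Poly_Mapping.lookup g l' when k + l = k + l') = Poly_Mapping.lookup g l"
    by simp
  finally show ?thesis .
qed

text \<open>The monomials in the prime ideal generated by all variables except \<open>x\<close>.\<close>
definition other_vars :: "'v set \<Rightarrow> 'v \<Rightarrow> ('v \<Rightarrow>\<^sub>0 nat) set" where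
  "other_vars V x = {m \<in> monomials V. \<exists>y\<in>V - {x}. Poly_Mapping.lookup m y \<noteq> 0}"

text \<open>The monomials of the colon ideal \<open>J : x\<^sup>\<infinity>\<close>, where \<open>J\<close> is the span of \<open>A\<close>.\<close>
definition saturation :: "'v \<Rightarrow> ('v \<Rightarrow>\<^sub>0 nat) set \<Rightarrow> ('v \<Rightarrow>\<^sub>0 nat) set" where
  "saturation x A = {m. \<exists>a. m + Poly_Mapping.single x a \<in> A}"

lemma absorbing_other_vars: "absorbing V (other_vars V x)"
  by (auto simp: absorbing_def other_vars_def monomials_add lookup_add)

text \<open>Modulo the prime generated by the variables other than \<open>x\<close>, the polynomial \<open>u\<close> is a nonzero
  polynomial in \<open>x\<close>. Among the terms of \<open>r\<close> outside the saturation choose the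
  lexicographically least one with respect to the degree in the other variables and the
  exponent of \<open>x\<close>, and choose the least pure power of \<open>x\<close> among the terms of \<open>u\<close>. A term of
  \<open>r\<close> inside the saturation cannot contribute to the coefficient of their product monomial,
  since that would put this monomial into the saturation; by minimality no other pair
  contributes either. So the coefficient is nonzero and the chosen term of \<open>r\<close> is in the
  saturation after all. Minimality in this order is what makes the argument work for a
  polynomial \<open>u\<close> that is not a monomial.\<close>
lemma colon_in_saturation:
  fixes u r :: "('v, 'k::idom) mpoly"
  assumes "finite V" and abs: "absorbing V A"
    and u: "u \<in> mspan (monomials V)" "u \<notin> mspan (other_vars V x)"
    and r: "r \<in> mspan (monomials V)"
    and ur: "u * r \<in> mspan A"
  shows "r \<in> mspan (saturation x A)"
proof (rule ccontr)
  assume "r \<notin> mspan (saturation x A)"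
  define off where "off m = (\<Sum>y\<in>V - {x}. Poly_Mapping.lookup m y)" for m :: "'v \<Rightarrow>\<^sub>0 nat"
  have off_add: "off (m + n) = off m + off n" for m n
    by (simp add: off_def lookup_add sum.distrib)
  have pure: "m = Poly_Mapping.single x (Poly_Mapping.lookup m x)"
    if "m \<in> monomials V" "off m = 0" for m
  proof (rule poly_mapping_eqI)
    fix y
    show "Poly_Mapping.lookup m y = Poly_Mapping.lookup (Poly_Mapping.single x (Poly_Mapping.lookup m x)) y"
      using that \<open>finite V\<close> by (cases "y \<in> V") (auto simp: off_def monomials_def lookup_single when_def in_keys_iff)
  qed
  define B where "B = Poly_Mapping.keys r - saturation x A"
  have "B \<noteq> {}" using \<open>r \<notin> mspan (saturation x A)\<close> by (auto simp: B_def mspan_def)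
  then obtain m0 where "m0 \<in> B" by blast
  have "wf (inv_image (less_than <*lex*> less_than) (\<lambda>m. (off m, Poly_Mapping.lookup m x)))"
    by (intro wf_inv_image wf_lex_prod wf_less_than)
  from wfE_min[OF this \<open>m0 \<in> B\<close>] obtain m where m: "m \<in> B"
    and m_min: "\<And>n. (n, m) \<in> inv_image (less_than <*lex*> less_than) (\<lambda>m. (off m, Poly_Mapping.lookup m x)) \<Longrightarrow> n \<notin> B"
    by blast
  have m_min: "off m < off n \<or> (off m = off n \<and> Poly_Mapping.lookup m x \<le> Poly_Mapping.lookup n x)"
    if "n \<in> B" for n
  proof -
    have "\<not> (off n < off m \<or> (off n = off m \<and> Poly_Mapping.lookup n x < Poly_Mapping.lookup m x))"
      using m_min[of n] that by auto
    then show ?thesis by auto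
  qed
  obtain k0 where k0: "k0 \<in> Poly_Mapping.keys u" "k0 \<notin> other_vars V x"
    using u(2) unfolding mspan_def by blast
  then have "k0 \<in> Poly_Mapping.keys u \<and> off k0 = 0"
    using u(1) by (auto simp: mspan_def other_vars_def off_def)
  from ex_has_least_nat[of "\<lambda>k. k \<in> Poly_Mapping.keys u \<and> off k = 0", OF this, of "\<lambda>k. Poly_Mapping.lookup k x"]
  obtain k where k: "k \<in> Poly_Mapping.keys u" "off k = 0"
    and k_min: "\<And>k'. k' \<in> Poly_Mapping.keys u \<Longrightarrow> off k' = 0 \<Longrightarrow> Poly_Mapping.lookup k x \<le> Poly_Mapping.lookup k' x"
    by blast
  have u_mon: "k' \<in> monomials V" if "k' \<in> Poly_Mapping.keys u" for k' using u that by (auto simp: mspan_def)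
  have k_pure: "k = Poly_Mapping.single x (Poly_Mapping.lookup k x)" using pure u_mon k by blast
  have m_not: "k + m + Poly_Mapping.single x a \<notin> A" for a
  proof
    assume "k + m + Poly_Mapping.single x a \<in> A"
    then have "m + Poly_Mapping.single x (Poly_Mapping.lookup k x + a) \<in> A"
      by (subst (asm) k_pure) (simp add: single_add add_ac)
    then show False using m by (auto simp: B_def saturation_def)
  qed
  have "k' = k" if k': "k' \<in> Poly_Mapping.keys u" and n: "n \<in> Poly_Mapping.keys r" and eq: "k' + n = k + m" for k' n
  proof -
    have "n \<notin> saturation x A"
    proof
      assume "n \<in> saturation x A"
      then obtain a where "n + Poly_Mapping.single x a \<in> A" by (auto simp: saturation_def)
      then have "n + Poly_Mapping.single x a + k' \<in> A"
        using abs u_mon[OF k'] by (auto simp: absorbing_def)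
      moreover have "n + Poly_Mapping.single x a + k' = k' + n + Poly_Mapping.single x a"
        by (simp add: add_ac)
      ultimately have "k + m + Poly_Mapping.single x a \<in> A" by (simp add: eq)
      then show False using m_not by blast
    qed
    then have nB: "n \<in> B" using n by (simp add: B_def)
    have "off k' + off n = off m" using arg_cong[OF eq, of off] k by (simp add: off_add)
    then have off: "off k' = 0" "off n = off m" using m_min[OF nB] by auto
    have "Poly_Mapping.lookup k' x + Poly_Mapping.lookup n x = Poly_Mapping.lookup k x + Poly_Mapping.lookup m x"
      using arg_cong[OF eq, of "\<lambda>p. Poly_Mapping.lookup p x"] by (simp add: lookup_add)
    then have "Poly_Mapping.lookup k' x = Poly_Mapping.lookup k x"
      using m_min[OF nB] k_min[OF k' off(1)] off(2) by auto
    then show ?thesis using pure[OF u_mon[OF k'] off(1)] k_pure by simp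
  qed
  then have "Poly_Mapping.lookup (u * r) (k + m) = Poly_Mapping.lookup u k * Poly_Mapping.lookup r m"
    by (rule lookup_mult_unique)
  also have "\<dots> \<noteq> 0" using k m by (simp add: B_def in_keys_iff)
  finally have "k + m \<in> A" using ur by (auto simp: mspan_def in_keys_iff)
  then show False using m_not[of 0] by simp
qed

text \<open>This ideal is its own saturation at \<open>x\<close>, so primality is a special case of the preceding
  lemma.\<close>
lemma primeideal_other_vars:
  assumes "finite V" and "x \<in> V"
  shows "primeideal (mspan (other_vars V x) :: ('v, 'k::idom) mpoly set) (poly_ring V)"
proof (rule primeidealI)
  show "ideal (mspan (other_vars V x) :: ('v, 'k) mpoly set) (poly_ring V)"
    by (rule ideal_mspan[OF absorbing_other_vars])
  show "cring (poly_ring V :: ('v, 'k) mpoly ring)" by (rule cring_poly_ring)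
  have "(1 :: ('v, 'k) mpoly) \<in> mspan (monomials V)" "(1 :: ('v, 'k) mpoly) \<notin> mspan (other_vars V x)"
    by (auto simp: mspan_def other_vars_def monomials_zero)
  then show "carrier (poly_ring V) \<noteq> (mspan (other_vars V x) :: ('v, 'k) mpoly set)"
    unfolding poly_ring_simps by blast
  fix a b :: "('v, 'k) mpoly"
  assume a: "a \<in> carrier (poly_ring V)" and b: "b \<in> carrier (poly_ring V)"
    and ab: "a \<otimes>\<^bsub>poly_ring V\<^esub> b \<in> mspan (other_vars V x)"
  show "a \<in> mspan (other_vars V x) \<or> b \<in> mspan (other_vars V x)"
  proof (rule disjCI)
    assume *: "b \<notin> mspan (other_vars V x)"
    have "b * a \<in> mspan (other_vars V x)"
      using ab by (simp add: poly_ring_simps mult.commute)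
    from colon_in_saturation[OF \<open>finite V\<close> absorbing_other_vars _ * _ this] a b
    have "a \<in> mspan (saturation x (other_vars V x))" by (simp add: poly_ring_simps)
    moreover have "saturation x (other_vars V x) \<subseteq> other_vars V x"
      by (auto simp: saturation_def other_vars_def monomials_add lookup_add lookup_single)
    ultimately show "a \<in> mspan (other_vars V x)" using mspan_mono by blast
  qed
qed

lemma associated_prime_of_colon:
  assumes abs: "absorbing V A" and f: "f \<in> monomials V"
    and colon: "\<And>m. m \<in> monomials V \<Longrightarrow> m + f \<in> A \<longleftrightarrow> m \<in> Q" and Q: "Q \<subseteq> monomials V"
    and prime: "primeideal (mspan Q :: ('v, 'k::comm_ring_1) mpoly set) (poly_ring V)"
  shows "(mspan Q :: ('v, 'k) mpoly set) \<in> associated_primes (poly_ring V) (mspan A)"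
proof -
  let ?R = "poly_ring V :: ('v, 'k) mpoly ring" and ?I = "mspan A :: ('v, 'k) mpoly set"
  let ?f = "Poly_Mapping.single f 1 :: ('v, 'k) mpoly"
  interpret I: ideal ?I ?R using abs by (rule ideal_mspan)
  have fc: "?f \<in> carrier ?R" using f by (simp add: poly_ring_simps mspan_single)
  have "(?I +>\<^bsub>?R\<^esub> r) \<otimes>\<^bsub>?R Quot ?I\<^esub> (?I +>\<^bsub>?R\<^esub> ?f) = \<zero>\<^bsub>?R Quot ?I\<^esub> \<longleftrightarrow> r \<in> mspan Q"
    if r: "r \<in> carrier ?R" for r
  proof -
    have rf: "r \<otimes>\<^bsub>?R\<^esub> ?f \<in> carrier ?R" using r fc by (rule I.m_closed)
    have "(?I +>\<^bsub>?R\<^esub> r) \<otimes>\<^bsub>?R Quot ?I\<^esub> (?I +>\<^bsub>?R\<^esub> ?f) = \<zero>\<^bsub>?R Quot ?I\<^esub> \<longleftrightarrow>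
        ?I +>\<^bsub>?R\<^esub> (r \<otimes>\<^bsub>?R\<^esub> ?f) = ?I"
      using r fc by (simp add: FactRing_def I.rcoset_mult_add)
    also have "\<dots> \<longleftrightarrow> r * ?f \<in> ?I"
      using I.rcos_const_imp_mem[OF rf] I.a_rcos_zero[OF I.ideal_axioms] by (auto simp: poly_ring_simps)
    also have "\<dots> \<longleftrightarrow> (\<forall>m\<in>Poly_Mapping.keys r. m + f \<in> A)"
    proof
      assume *: "r * ?f \<in> ?I"
      show "\<forall>m\<in>Poly_Mapping.keys r. m + f \<in> A"
      proof
        fix m assume m: "m \<in> Poly_Mapping.keys r"
        have "Poly_Mapping.lookup (r * ?f) (m + f) = Poly_Mapping.lookup r m * Poly_Mapping.lookup ?f f"
          by (rule lookup_mult_unique) auto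
        then have "m + f \<in> Poly_Mapping.keys (r * ?f)" using m by (simp add: in_keys_iff)
        then show "m + f \<in> A" using * by (auto simp: mspan_def)
      qed
    next
      assume "\<forall>m\<in>Poly_Mapping.keys r. m + f \<in> A"
      then show "r * ?f \<in> ?I" using keys_mult[of r ?f] by (auto simp: mspan_def)
    qed
    also have "\<dots> \<longleftrightarrow> r \<in> mspan Q"
      using colon r by (auto simp: mspan_def poly_ring_simps)
    finally show ?thesis .
  qed
  then have "mspan Q = {r \<in> carrier ?R. (?I +>\<^bsub>?R\<^esub> r) \<otimes>\<^bsub>?R Quot ?I\<^esub> (?I +>\<^bsub>?R\<^esub> ?f) = \<zero>\<^bsub>?R Quot ?I\<^esub>}"
    using mspan_mono[OF Q] by (auto simp: poly_ring_simps)
  moreover have "?I +>\<^bsub>?R\<^esub> ?f \<in> carrier (?R Quot ?I)"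
    using fc by (auto simp: FactRing_def A_RCOSETS_def')
  ultimately show ?thesis using prime unfolding associated_primes_def by blast
qed

section \<open>Edge ideals of weighted rooted trees\<close>

text \<open>An inner vertex of weight at least two still has a positive exponent after its weight is
  lowered by one. This is what makes the colon monomials below work.\<close>
locale weighted_planted_arborescence = planted_arborescence V E x0 x1
  for V :: "'v set" and E and x0 and x1 +
  fixes w :: "'v \<Rightarrow> nat"
  assumes w_pos: "\<And>y. y \<in> V \<Longrightarrow> 1 \<le> w y"
    and w_inner: "\<And>x y. (x, y) \<in> E \<Longrightarrow> x \<noteq> x0 \<Longrightarrow> 2 \<le> w x"
begin

definition edge_exps :: "('v \<Rightarrow>\<^sub>0 nat) set" where
  "edge_exps = {m \<in> monomials V. \<exists>x y. (x, y) \<in> E \<and> 1 \<le> Poly_Mapping.lookup m x \<and> w y \<le> Poly_Mapping.lookup m y}"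

text \<open>The condition \<open>c x0 = 0\<close> expresses that no arc ends in the root.\<close>
definition power_exps :: "nat \<Rightarrow> ('v \<Rightarrow>\<^sub>0 nat) set" where
  "power_exps s = {m \<in> monomials V. \<exists>c. packs E w V (Poly_Mapping.lookup m) c \<and> c x0 = 0 \<and> sum c V = s}"

definition edge_monomial :: "'v \<times> 'v \<Rightarrow> 'v \<Rightarrow>\<^sub>0 nat" where
  "edge_monomial e = Poly_Mapping.single (fst e) 1 + Poly_Mapping.single (snd e) (w (snd e))"

lemma arc_ne: "(x, y) \<in> E \<Longrightarrow> x \<noteq> y"
  using acyc by (auto simp: acyclic_def)

lemma arc_in_V: "(x, y) \<in> E \<Longrightarrow> x \<in> V \<and> y \<in> V"
  using arcs_sub by auto

lemma lookup_edge_monomial: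
  "(x, y) \<in> E \<Longrightarrow> Poly_Mapping.lookup (edge_monomial (x, y)) v = (if v = x then 1 else if v = y then w y else 0)"
  using arc_ne[of x y] by (auto simp: edge_monomial_def lookup_add lookup_single when_def)

lemma edge_monomial_in: "e \<in> E \<Longrightarrow> edge_monomial e \<in> monomials V"
  using arc_in_V[of "fst e" "snd e"]
  by (auto simp: edge_monomial_def monomials_add monomials_single)

lemma monomial_quotient:
  assumes "(x, y) \<in> E" and "m \<in> monomials V" and "1 \<le> Poly_Mapping.lookup m x" and "w y \<le> Poly_Mapping.lookup m y"
  obtains n where "n \<in> monomials V" and "m = n + edge_monomial (x, y)"
proof
  have le: "Poly_Mapping.lookup (edge_monomial (x, y)) v \<le> Poly_Mapping.lookup m v" for v
    using assms by (auto simp: lookup_edge_monomial)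
  show "m = (m - edge_monomial (x, y)) + edge_monomial (x, y)"
    using le by (intro poly_mapping_eqI) (simp add: lookup_add lookup_minus)
  then show "m - edge_monomial (x, y) \<in> monomials V"
    using assms(2) by (metis monomials_add)
qed

lemma edge_exps_eq: "edge_exps = {t + n |t n. t \<in> edge_monomial ` E \<and> n \<in> monomials V}"
proof
  show "edge_exps \<subseteq> {t + n |t n. t \<in> edge_monomial ` E \<and> n \<in> monomials V}"
  proof
    fix m assume "m \<in> edge_exps"
    then obtain x y where xy: "(x, y) \<in> E" "m \<in> monomials V" "1 \<le> Poly_Mapping.lookup m x" "w y \<le> Poly_Mapping.lookup m y"
      by (auto simp: edge_exps_def)
    then obtain n where "n \<in> monomials V" "m = n + edge_monomial (x, y)" by (rule monomial_quotient)
    then have "n \<in> monomials V" "m = edge_monomial (x, y) + n" by (simp_all add: add.commute)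
    then show "m \<in> {t + n |t n. t \<in> edge_monomial ` E \<and> n \<in> monomials V}"
      using xy(1) by blast
  qed
  show "{t + n |t n. t \<in> edge_monomial ` E \<and> n \<in> monomials V} \<subseteq> edge_exps"
  proof
    fix m assume "m \<in> {t + n |t n. t \<in> edge_monomial ` E \<and> n \<in> monomials V}"
    then obtain x y n where m: "m = edge_monomial (x, y) + n" "(x, y) \<in> E" "n \<in> monomials V" by auto
    then have "m \<in> monomials V" "1 \<le> Poly_Mapping.lookup m x" "w y \<le> Poly_Mapping.lookup m y"
      using edge_monomial_in[of "(x, y)"] arc_ne[of x y]
      by (auto simp: monomials_add lookup_add lookup_edge_monomial)
    then show "m \<in> edge_exps" using m(2) by (auto simp: edge_exps_def)
  qed
qed

lemma absorbing_edge_exps: "absorbing V edge_exps"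
  unfolding edge_exps_eq using edge_monomial_in by (intro absorbing_generated) blast

lemma absorbing_power_exps: "absorbing V (power_exps s)"
proof -
  have "packs E w V (Poly_Mapping.lookup (m + n)) c" if "packs E w V (Poly_Mapping.lookup m) c" for m n c
    using that by (auto simp: packs_def lookup_add intro: trans_le_add1)
  then show ?thesis by (auto simp: absorbing_def power_exps_def monomials_add)
qed

lemma packs_add_edge:
  assumes xy: "(x, y) \<in> E" and nm: "\<And>v. m v = n v + Poly_Mapping.lookup (edge_monomial (x, y)) v"
  shows "packs E w V m (c(y := Suc (c y))) \<longleftrightarrow> packs E w V n c"
proof -
  have ch: "(\<Sum>z\<in>E `` {v}. (c(y := Suc (c y))) z) = (\<Sum>z\<in>E `` {v}. c z) + (if v = x then 1 else 0)" for v
  proof -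
    have "(\<Sum>z\<in>E `` {v}. (c(y := Suc (c y))) z) = (\<Sum>z\<in>E `` {v}. c z + (if z = y then 1 else 0))"
      by (rule sum.cong) auto
    also have "\<dots> = (\<Sum>z\<in>E `` {v}. c z) + (if y \<in> E `` {v} then 1 else 0)"
      using finite_children by (simp add: sum.distrib)
    also have "y \<in> E `` {v} \<longleftrightarrow> v = x" using xy unique_parent by blast
    finally show ?thesis .
  qed
  have "w v * (c(y := Suc (c y))) v + (\<Sum>z\<in>E `` {v}. (c(y := Suc (c y))) z) \<le> m v \<longleftrightarrow>
      w v * c v + (\<Sum>z\<in>E `` {v}. c z) \<le> n v" for v
    unfolding ch nm using arc_ne[OF xy] by (auto simp: lookup_edge_monomial[OF xy])
  then show ?thesis by (simp only: packs_def)
qed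

lemma power_exps_0: "power_exps 0 = monomials V"
proof -
  have "packs E w V (Poly_Mapping.lookup m) (\<lambda>_. 0)" for m by (simp add: packs_def)
  then show ?thesis by (force simp: power_exps_def)
qed

text \<open>Removing one arc from a nonempty packing amounts to dividing by its generator.\<close>
lemma power_exps_Suc: "power_exps (Suc s) = {a + b |a b. a \<in> power_exps s \<and> b \<in> edge_exps}"
proof
  show "power_exps (Suc s) \<subseteq> {a + b |a b. a \<in> power_exps s \<and> b \<in> edge_exps}"
  proof
    fix m assume "m \<in> power_exps (Suc s)"
    then obtain c where c: "m \<in> monomials V" "packs E w V (Poly_Mapping.lookup m) c" "c x0 = 0" "sum c V = Suc s"
      by (auto simp: power_exps_def)
    then obtain y where y: "y \<in> V" "c y \<noteq> 0" by (metis sum.neutral nat.distinct(1))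
    then have "y \<noteq> x0" using c by auto
    then obtain x where xy: "(x, y) \<in> E" using has_parent y by blast
    have "c y \<le> (\<Sum>z\<in>E `` {x}. c z)"
      using xy finite_children by (intro member_le_sum) auto
    also have "\<dots> \<le> Poly_Mapping.lookup m x" using c(2) arc_in_V[OF xy] by (auto simp: packs_def)
    finally have mx: "1 \<le> Poly_Mapping.lookup m x" using y by simp
    have "w y * 1 \<le> w y * c y" using y by (intro mult_le_mono2) simp
    also have "\<dots> \<le> Poly_Mapping.lookup m y" using c(2) y by (auto simp: packs_def)
    finally have my: "w y \<le> Poly_Mapping.lookup m y" by simp
    obtain n where n: "n \<in> monomials V" "m = n + edge_monomial (x, y)"
      using monomial_quotient[OF xy c(1) mx my] .
    define d where "d = c(y := c y - 1)"
    have cd: "c = d(y := Suc (d y))" using y by (auto simp: d_def)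
    have "packs E w V (Poly_Mapping.lookup n) d"
      using c(2) packs_add_edge[OF xy, of "Poly_Mapping.lookup m" "Poly_Mapping.lookup n" d] n(2) unfolding cd[symmetric]
      by (simp add: lookup_add)
    moreover have "d x0 = 0" using c(3) \<open>y \<noteq> x0\<close> by (simp add: d_def)
    moreover have "sum c V = Suc (sum d V)"
      using finite_V y(1) by (subst cd) (simp add: sum.remove)
    ultimately have "n \<in> power_exps s" using n(1) c(4) by (auto simp: power_exps_def)
    moreover have "edge_monomial (x, y) \<in> edge_exps"
      unfolding edge_exps_eq using xy monomials_zero by force
    ultimately show "m \<in> {a + b |a b. a \<in> power_exps s \<and> b \<in> edge_exps}" using n(2) by blast
  qed
  show "{a + b |a b. a \<in> power_exps s \<and> b \<in> edge_exps} \<subseteq> power_exps (Suc s)"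
  proof
    fix m assume "m \<in> {a + b |a b. a \<in> power_exps s \<and> b \<in> edge_exps}"
    then obtain a x y n where m: "m = a + (edge_monomial (x, y) + n)" "a \<in> power_exps s"
      "(x, y) \<in> E" "n \<in> monomials V" unfolding edge_exps_eq by auto
    obtain c where c: "a \<in> monomials V" "packs E w V (Poly_Mapping.lookup a) c" "c x0 = 0" "sum c V = s"
      using m(2) by (auto simp: power_exps_def)
    have "y \<noteq> x0" "y \<in> V" using m(3) no_parent_root arc_in_V by auto
    let ?c = "c(y := Suc (c y))"
    have "packs E w V (Poly_Mapping.lookup (a + edge_monomial (x, y))) ?c"
      using c(2) packs_add_edge[OF m(3)] by (simp add: lookup_add)
    moreover have "sum ?c V = Suc s"
      using finite_V \<open>y \<in> V\<close> c(4) by (simp add: sum.remove)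
    ultimately have "a + edge_monomial (x, y) \<in> power_exps (Suc s)"
      using c \<open>y \<noteq> x0\<close> m(3) edge_monomial_in
      by (auto simp: power_exps_def monomials_add intro!: exI[of _ ?c])
    then show "m \<in> power_exps (Suc s)"
      using absorbing_power_exps m(1,4) by (auto simp: absorbing_def add.assoc[symmetric])
  qed
qed

lemma ideal_power_edge_exps:
  "ideal_power (poly_ring V) (mspan edge_exps) s = (mspan (power_exps s) :: ('v, 'k::comm_ring_1) mpoly set)"
proof (induction s)
  case 0
  then show ?case
    by (simp add: ideal_power_def ideals_set_def power_exps_0 poly_ring_simps)
next
  case (Suc s)
  then show ?case
    by (simp add: ideal_power_def ideals_set_def power_exps_Suc ideal_prod_mspan)
qed

text \<open>The variables other than \<open>x0\<close> generate the ideal \<open>I : f\<close>, where \<open>f\<close> is the product of \<open>x0\<close>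
  and all \<open>y\<^bsup>w y - 1\<^esup>\<close> with \<open>y \<noteq> x0\<close>: one further factor \<open>y\<close> completes the generator of the
  arc into \<open>y\<close>, because the tail of that arc occurs in \<open>f\<close>, whereas powers of \<open>x0\<close> complete
  nothing.\<close>
lemma colon_root:
  obtains f where "f \<in> monomials V"
    and "\<And>m. m \<in> monomials V \<Longrightarrow> m + f \<in> edge_exps \<longleftrightarrow> m \<in> other_vars V x0"
proof
  define F where "F y = (if y = x0 then 1 else if y \<in> V then w y - 1 else 0)" for y
  define f where "f = Abs_poly_mapping F"
  have "{y. F y \<noteq> 0} \<subseteq> V" using root_in by (auto simp: F_def)
  then have "finite {y. F y \<noteq> 0}" using finite_V by (rule finite_subset)
  then have f: "Poly_Mapping.lookup f = F" unfolding f_def by (rule lookup_Abs_poly_mapping)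
  show fV: "f \<in> monomials V"
    using \<open>{y. F y \<noteq> 0} \<subseteq> V\<close> by (auto simp: monomials_def in_keys_iff f)
  fix m assume m: "m \<in> monomials V"
  show "m + f \<in> edge_exps \<longleftrightarrow> m \<in> other_vars V x0"
  proof
    assume "m + f \<in> edge_exps"
    then obtain x y where xy: "(x, y) \<in> E" "w y \<le> Poly_Mapping.lookup m y + F y"
      by (auto simp: edge_exps_def lookup_add f)
    have y: "y \<in> V" "y \<noteq> x0" using xy(1) arc_in_V no_parent_root by auto
    then have "Poly_Mapping.lookup m y \<noteq> 0" using xy(2) w_pos[OF y(1)] by (auto simp: F_def)
    then show "m \<in> other_vars V x0" using m y by (auto simp: other_vars_def)
  next
    assume "m \<in> other_vars V x0"
    then obtain y where y: "y \<in> V" "y \<noteq> x0" "Poly_Mapping.lookup m y \<noteq> 0" by (auto simp: other_vars_def)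
    then obtain x where xy: "(x, y) \<in> E" using has_parent by blast
    have "1 \<le> F x" using w_inner[OF xy] arc_in_V[OF xy] by (auto simp: F_def)
    moreover have "w y \<le> Poly_Mapping.lookup m y + F y" using y by (auto simp: F_def)
    ultimately have "1 \<le> Poly_Mapping.lookup (m + f) x" "w y \<le> Poly_Mapping.lookup (m + f) y"
      "m + f \<in> monomials V"
      using m fV by (simp_all add: lookup_add f monomials_add)
    then show "m + f \<in> edge_exps" using xy unfolding edge_exps_def by blast
  qed
qed

text \<open>For \<open>x1\<close> the factor \<open>x0\<close> is left out of \<open>f\<close> and the exponent of \<open>x1\<close> is raised to \<open>w x1\<close>:
  then a factor \<open>x0\<close> completes the generator of \<open>(x0, x1)\<close>, and powers of \<open>x1\<close> complete
  nothing.\<close>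
lemma colon_child:
  obtains f where "f \<in> monomials V"
    and "\<And>m. m \<in> monomials V \<Longrightarrow> m + f \<in> edge_exps \<longleftrightarrow> m \<in> other_vars V x1"
proof
  define F where "F y = (if y = x0 then 0 else if y = x1 then w x1 else if y \<in> V then w y - 1 else 0)" for y
  define f where "f = Abs_poly_mapping F"
  have root_arc: "(x0, x1) \<in> E" using root_child by blast
  have x1V: "x1 \<in> V" using arc_in_V[OF root_arc] by blast
  have "{y. F y \<noteq> 0} \<subseteq> V" using x1V by (auto simp: F_def)
  then have "finite {y. F y \<noteq> 0}" using finite_V by (rule finite_subset)
  then have f: "Poly_Mapping.lookup f = F" unfolding f_def by (rule lookup_Abs_poly_mapping)
  show fV: "f \<in> monomials V"
    using \<open>{y. F y \<noteq> 0} \<subseteq> V\<close> by (auto simp: monomials_def in_keys_iff f)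
  fix m assume m: "m \<in> monomials V"
  show "m + f \<in> edge_exps \<longleftrightarrow> m \<in> other_vars V x1"
  proof
    assume "m + f \<in> edge_exps"
    then obtain x y where xy: "(x, y) \<in> E" "1 \<le> Poly_Mapping.lookup m x + F x" "w y \<le> Poly_Mapping.lookup m y + F y"
      by (auto simp: edge_exps_def lookup_add f)
    have y: "y \<in> V" "y \<noteq> x0" using xy(1) arc_in_V no_parent_root by auto
    show "m \<in> other_vars V x1"
    proof (cases "y = x1")
      case True
      then have "x = x0" using xy(1) root_arc unique_parent by blast
      then have "Poly_Mapping.lookup m x0 \<noteq> 0" using xy(2) by (simp add: F_def)
      then show ?thesis using m root_in child_ne_root by (auto simp: other_vars_def)
    next
      case False
      then have "Poly_Mapping.lookup m y \<noteq> 0" using xy(3) w_pos[OF y(1)] y by (auto simp: F_def)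
      then show ?thesis using m y False by (auto simp: other_vars_def)
    qed
  next
    assume "m \<in> other_vars V x1"
    then obtain y where y: "y \<in> V" "y \<noteq> x1" "Poly_Mapping.lookup m y \<noteq> 0" by (auto simp: other_vars_def)
    have "\<exists>x z. (x, z) \<in> E \<and> 1 \<le> Poly_Mapping.lookup m x + F x \<and> w z \<le> Poly_Mapping.lookup m z + F z"
    proof (cases "y = x0")
      case True
      then have "1 \<le> Poly_Mapping.lookup m x0 + F x0" "w x1 \<le> Poly_Mapping.lookup m x1 + F x1"
        using y child_ne_root by (auto simp: F_def)
      then show ?thesis using root_arc by blast
    next
      case False
      then obtain x where xy: "(x, y) \<in> E" using has_parent y by blast
      have "x \<noteq> x0" using xy root_child y(2) by blast
      then have "1 \<le> F x" using w_inner[OF xy] arc_in_V[OF xy] by (auto simp: F_def)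
      moreover have "w y \<le> Poly_Mapping.lookup m y + F y" using y False by (auto simp: F_def)
      ultimately show ?thesis using xy trans_le_add2 by blast
    qed
    then show "m + f \<in> edge_exps"
      using m fV by (auto simp: edge_exps_def lookup_add f monomials_add)
  qed
qed

lemma saturation_power_exps:
  assumes "m \<in> monomials V" and "m \<in> saturation x (power_exps s)"
  obtains a c where "packs E w V ((Poly_Mapping.lookup m)(x := Poly_Mapping.lookup m x + a)) c" "c x0 = 0" "sum c V = s"
proof -
  obtain a where "m + Poly_Mapping.single x a \<in> power_exps s"
    using assms(2) by (auto simp: saturation_def)
  moreover have "Poly_Mapping.lookup (m + Poly_Mapping.single x a) = (Poly_Mapping.lookup m)(x := Poly_Mapping.lookup m x + a)"
    by (auto simp: lookup_add lookup_single when_def)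
  ultimately show thesis using that by (auto simp: power_exps_def)
qed

text \<open>The symbolic power is contained in the local contractions at the two associated primes that
  omit \<open>x0\<close> and \<open>x1\<close>, hence in the saturations of the power at \<open>x0\<close> and \<open>x1\<close>; these meet in
  the power itself.\<close>
lemma symbolic_power_edge_exps:
  "symbolic_power (poly_ring V) (mspan edge_exps :: ('v, 'k::field) mpoly set) s \<subseteq> mspan (power_exps s)"
proof
  fix r :: "('v, 'k) mpoly"
  assume r: "r \<in> symbolic_power (poly_ring V) (mspan edge_exps) s"
  then have rc: "r \<in> mspan (monomials V)" by (simp add: symbolic_power_def poly_ring_simps)
  have sat: "r \<in> mspan (saturation x (power_exps s))"
    if x: "x \<in> V" and f: "f \<in> monomials V"
      and colon: "\<And>m. m \<in> monomials V \<Longrightarrow> m + f \<in> edge_exps \<longleftrightarrow> m \<in> other_vars V x" for x f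
  proof -
    let ?P = "mspan (other_vars V x) :: ('v, 'k) mpoly set"
    have prime: "primeideal ?P (poly_ring V)"
      using finite_V x by (rule primeideal_other_vars)
    have "other_vars V x \<subseteq> monomials V" by (auto simp: other_vars_def)
    then have "?P \<in> associated_primes (poly_ring V) (mspan edge_exps)"
      using associated_prime_of_colon[OF absorbing_edge_exps f colon _ prime] by blast
    then have "r \<in> local_contraction (poly_ring V) ?P (mspan (power_exps s))"
      using r unfolding symbolic_power_def ideal_power_edge_exps by blast
    from local_contraction_colon[OF prime ideal_mspan[OF absorbing_power_exps] this]
    obtain u where "u \<in> carrier (poly_ring V) - ?P" "u \<otimes>\<^bsub>poly_ring V\<^esub> r \<in> mspan (power_exps s)" .
    then show ?thesis
      using colon_in_saturation[OF finite_V absorbing_power_exps _ _ rc] by (auto simp: poly_ring_simps)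
  qed
  have x1V: "x1 \<in> V" using root_child arc_in_V by blast
  have s0: "r \<in> mspan (saturation x0 (power_exps s))"
    using colon_root sat[OF root_in] by metis
  have s1: "r \<in> mspan (saturation x1 (power_exps s))"
    using colon_child sat[OF x1V] by metis
  have "m \<in> power_exps s" if "m \<in> Poly_Mapping.keys r" for m
  proof -
    have m: "m \<in> monomials V" "m \<in> saturation x0 (power_exps s)" "m \<in> saturation x1 (power_exps s)"
      using that rc s0 s1 by (auto simp: mspan_def)
    obtain a c where c: "packs E w V ((Poly_Mapping.lookup m)(x0 := Poly_Mapping.lookup m x0 + a)) c" "c x0 = 0" "sum c V = s"
      using saturation_power_exps[OF m(1,2)] .
    obtain b d where d: "packs E w V ((Poly_Mapping.lookup m)(x1 := Poly_Mapping.lookup m x1 + b)) d" "d x0 = 0" "sum d V = s"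
      using saturation_power_exps[OF m(1,3)] .
    obtain e where "packs E w V (Poly_Mapping.lookup m) e" "e x0 = 0" "sum e V = s"
      using saturations_meet[OF w_pos c d] .
    then show ?thesis using m(1) by (auto simp: power_exps_def)
  qed
  then show "r \<in> mspan (power_exps s)" by (auto simp: mspan_def)
qed

end

lemma var_power: "var y ^ n = Poly_Mapping.single (Poly_Mapping.single y n) 1"
  by (induction n) (simp_all add: var_def mult_single flip: single_add)

lemma ideal_subset_local_contraction:
  assumes "J \<subseteq> carrier R"
  shows "J \<subseteq> local_contraction R P J"
  using assms by (auto simp: local_contraction_def extension_ideal_def genideal_def)

theorem theorem6p6:
  fixes D :: "'v pair_pre_digraph" and w :: "'v \<Rightarrow> nat" and x\<^sub>0 :: 'v and s :: nat
  assumes "weighted_rooted_tree D w x\<^sub>0"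
    and "graph_degree D x\<^sub>0 = 1"
    and "\<And>x. x \<in> pverts D \<Longrightarrow> graph_degree D x \<ge> 2 \<Longrightarrow> w x \<ge> 2"
    and "s \<ge> 2"
  shows "symbolic_power (poly_ring (pverts D)) (edge_ideal D w :: ('v, 'k::field) mpoly set) s =
    ideal_power (poly_ring (pverts D)) (edge_ideal D w) s"
proof -
  have tree: "rooted_tree D x\<^sub>0" and weights: "weighted_oriented_graph D w"
    using assms(1) by (auto simp: weighted_rooted_tree_def)
  interpret arborescence "pverts D" "parcs D" x\<^sub>0
    using tree by (rule rooted_tree_arborescence)
  have neighbours: "neighbours D x = {y. (x, y) \<in> parcs D \<or> (y, x) \<in> parcs D}" for x
    using arcs_sub by (auto simp: neighbours_def parcs_symmetrization)
  have "card (parcs D `` {x\<^sub>0}) = 1"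
    using assms(2) no_parent_root by (simp add: graph_degree_def neighbours Image_singleton)
  then obtain x1 where x1: "parcs D `` {x\<^sub>0} = {x1}" by (rule card_1_singletonE)
  interpret weighted_planted_arborescence "pverts D" "parcs D" x\<^sub>0 x1 w
  proof
    show "parcs D `` {x\<^sub>0} = {x1}" by (rule x1)
    show "1 \<le> w y" if "y \<in> pverts D" for y
      using weights that by (simp add: weighted_oriented_graph_def)
    fix x y assume xy: "(x, y) \<in> parcs D" "x \<noteq> x\<^sub>0"
    then have x: "x \<in> pverts D" using arcs_sub by auto
    then obtain z where z: "(z, x) \<in> parcs D" using has_parent xy(2) by blast
    \<comment> \<open>The parent \<open>z\<close> and the child \<open>y\<close> of \<open>x\<close> are two different neighbours.\<close>
    have "z \<noteq> y"
      using weights xy(1) z by (auto simp: weighted_oriented_graph_def oriented_graph_def)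
    then have "card {y, z} = 2" by auto
    moreover have "{y, z} \<subseteq> neighbours D x" using xy z by (auto simp: neighbours)
    moreover have "finite (neighbours D x)" using finite_V by (simp add: neighbours_def)
    ultimately have "2 \<le> graph_degree D x" unfolding graph_degree_def by (metis card_mono)
    then show "2 \<le> w x" using assms(3) x by blast
  qed
  have gen: "var x * var y ^ w y = Poly_Mapping.single (edge_monomial (x, y)) (1 :: 'k)" for x y
    unfolding var_power by (simp add: var_def mult_single edge_monomial_def)
  have gens: "{var x * var y ^ w y |x y. (x, y) \<in> parcs D} =
      (\<lambda>t. Poly_Mapping.single t (1 :: 'k)) ` edge_monomial ` parcs D"
    unfolding gen by auto
  have I: "(edge_ideal D w :: ('v, 'k) mpoly set) = mspan edge_exps"
    unfolding edge_ideal_def gens edge_exps_eq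
    using edge_monomial_in by (intro genideal_monomials) blast
  have "(mspan (power_exps s) :: ('v, 'k) mpoly set) \<subseteq> carrier (poly_ring (pverts D))"
    unfolding poly_ring_simps by (rule mspan_mono) (auto simp: power_exps_def)
  then have "(mspan (power_exps s) :: ('v, 'k) mpoly set) \<subseteq>
      symbolic_power (poly_ring (pverts D)) (mspan edge_exps) s"
    unfolding symbolic_power_def ideal_power_edge_exps
    using ideal_subset_local_contraction by blast
  then show ?thesis
    unfolding I ideal_power_edge_exps using symbolic_power_edge_exps by blast
qed

end
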